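(* Let $G$ be a compact abelian group with countable dual group $\widehat{G}$ and Haar probability measure $\mathbf{m}$, let $\Omega=\mathrm{Epi}(G)^{\mathbb{N}}$ with shift $\sigma$, let $\mu$ be a $\sigma$-invariant probability measure on $\Omega$, and let $S(\omega,x)=(\sigma\omega,\omega_0x)$ on $\Omega\times G$. Suppose that this skew product of epimorphisms is Fourier tight. If $\mu$ is weakly $\sigma$-mixing, then $\mu\otimes\mathbf{m}$ is weakly $S$-mixing.
   Context: $\mathrm{Epi}(G)$ is the semigroup of continuous surjective endomorphisms of $G$; every such map preserves $\mathbf{m}$. Elements of $\Omega=\mathrm{Epi}(G)^{\mathbb{N}}$ are sequences $\omega=(\omega_n)_{n\ge 0}$, and $\sigma((\omega_n)_{n\ge0})=(\omega_{n+1})_{n\ge0}$. $\Omega$ carries a $\sigma$-algebra for which $\sigma$ is measurable and the map $(\omega,x)\mapsto \omega_0x$ from $\Omega\times G$ to $G$ (with $G$ carrying its Borel $\sigma$-algebra) is measurable. The skew product transformation is $S:\Omega\times G\to\Omega\times G$, $S(\omega,x)=(\sigma\omega,\omega_0x)$; it preserves $\mu\otimes\mathbf{m}$. For an endomorphism $\tau$ of $G$, its adjoint $\tau^*:\widehat G\to\widehat G$ is $\tau^*(\gamma)=\gamma\circ\tau$; $1$ denotes the trivial character. The skew product is called Fourier tight if for $\mu$-almost every $\omega$, for any finite set $\Gamma\subset\widehat{G}$ there is an integer $m_0=m_0(\omega,\Gamma)$ such that for all $m\ge m_0$, $(\omega_{m-1}\omega_{m-2}\cdots\omega_1\omega_0)^*(\widehat{G}\setminus\{1\})\subset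 \widehat G\setminus\Gamma$. A probability measure $\nu$ is weakly $T$-mixing if it is $T$-invariant and weakly mixing for $T$ (equivalently, $\nu\times\nu$ is ergodic for $T\times T$). *)

theory Defs
  imports "HOL-Probability.Probability"
begin

section \<open>Compact abelian groups\<close>

text \<open>The group is written additively; it is the universe of a type of class
  \<^class>\<open>topological_ab_group_add\<close>, assumed Hausdorff and compact in the theorem. The trivial
  character (called 1 in the multiplicative dual group) is the constant function 1.\<close>

definition dual_group :: "('g::topological_ab_group_add \<Rightarrow> complex) set" where
  "dual_group = {\<gamma>. continuous_on UNIV \<gamma> \<and> (\<forall>x. cmod (\<gamma> x) = 1) \<and>
     (\<forall>x y. \<gamma> (x + y) = \<gamma> x * \<gamma> y)}"

definition trivial_character :: "'g \<Rightarrow> complex" where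
  "trivial_character = (\<lambda>_. 1)"

text \<open>The normalised Haar measure of a compact group: the translation invariant regular Borel
  probability measure. For a finite Borel measure on a compact Hausdorff space, inner regularity
  by compact sets gives outer regularity by open sets on passing to complements.\<close>

definition haar_probability :: "'g::topological_ab_group_add measure \<Rightarrow> bool" where
  "haar_probability m \<longleftrightarrow> sets m = sets borel \<and> prob_space m \<and>
     (\<forall>a. distr m m (\<lambda>x. a + x) = m) \<and>
     (\<forall>A\<in>sets m. emeasure m A = (SUP K\<in>{K. K \<subseteq> A \<and> compact K}. emeasure m K))"

definition Epi :: "('g::topological_ab_group_add \<Rightarrow> 'g) set" where
  "Epi = {\<tau>. continuous_on UNIV \<tau> \<and> Modules.additive \<tau> \<and> surj \<tau>}"

definition adjoint_endo :: "('g \<Rightarrow> 'g) \<Rightarrow> ('g \<Rightarrow> complex) \<Rightarrow> ('g \<Rightarrow> complex)" where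
  "adjoint_endo \<tau> \<gamma> = \<gamma> \<circ> \<tau>"

section \<open>Ergodicity and weak mixing\<close>

definition measure_preserving_map :: "'a measure \<Rightarrow> ('a \<Rightarrow> 'a) \<Rightarrow> bool" where
  "measure_preserving_map M T \<longleftrightarrow> T \<in> measurable M M \<and> distr M M T = M"

definition ergodic_map :: "'a measure \<Rightarrow> ('a \<Rightarrow> 'a) \<Rightarrow> bool" where
  "ergodic_map M T \<longleftrightarrow> prob_space M \<and> measure_preserving_map M T \<and>
     (\<forall>A\<in>sets M. T -` A \<inter> space M = A \<longrightarrow> measure M A = 0 \<or> measure M A = 1)"

definition weakly_mixing_map :: "'a measure \<Rightarrow> ('a \<Rightarrow> 'a) \<Rightarrow> bool" where
  "weakly_mixing_map M T \<longleftrightarrow> prob_space M \<and> measure_preserving_map M T \<and>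
     ergodic_map (M \<Otimes>\<^sub>M M) (\<lambda>(x, y). (T x, T y))"

section \<open>Skew products of epimorphisms\<close>

definition Omega :: "(nat \<Rightarrow> 'g::topological_ab_group_add \<Rightarrow> 'g) set" where
  "Omega = {\<omega>. \<forall>n. \<omega> n \<in> Epi}"

definition shift_map :: "(nat \<Rightarrow> 'b) \<Rightarrow> (nat \<Rightarrow> 'b)" where
  "shift_map \<omega> = (\<lambda>n. \<omega> (Suc n))"

definition skew_product :: "(nat \<Rightarrow> 'g \<Rightarrow> 'g) \<times> 'g \<Rightarrow> (nat \<Rightarrow> 'g \<Rightarrow> 'g) \<times> 'g" where
  "skew_product = (\<lambda>(\<omega>, x). (shift_map \<omega>, \<omega> 0 x))"

text \<open>\<open>cocycle \<omega> m\<close> is the composition \<open>\<omega> (m - 1) \<circ> \<dots> \<circ> \<omega> 1 \<circ> \<omega> 0\<close>.\<close>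

primrec cocycle :: "(nat \<Rightarrow> 'g \<Rightarrow> 'g) \<Rightarrow> nat \<Rightarrow> 'g \<Rightarrow> 'g" where
  "cocycle \<omega> 0 = id"
| "cocycle \<omega> (Suc m) = \<omega> m \<circ> cocycle \<omega> m"

definition Fourier_tight :: "(nat \<Rightarrow> 'g::topological_ab_group_add \<Rightarrow> 'g) measure \<Rightarrow> bool" where
  "Fourier_tight \<mu> \<longleftrightarrow> (AE \<omega> in \<mu>. \<forall>\<Gamma>. finite \<Gamma> \<and> \<Gamma> \<subseteq> dual_group \<longrightarrow>
     (\<exists>m0. \<forall>m\<ge>m0. adjoint_endo (cocycle \<omega> m) ` (dual_group - {trivial_character})
        \<subseteq> dual_group - \<Gamma>))"

text \<open>The measure \<open>\<mu>\<close> carries the sigma-algebra of the sequence space, which is an arbitrary one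
  making the shift and the evaluation map measurable.\<close>

definition epi_base :: "(nat \<Rightarrow> 'g::topological_ab_group_add \<Rightarrow> 'g) measure \<Rightarrow> bool" where
  "epi_base \<mu> \<longleftrightarrow> space \<mu> = Omega \<and> prob_space \<mu> \<and>
     shift_map \<in> measurable \<mu> \<mu> \<and>
     (\<lambda>(\<omega>, x). \<omega> 0 x) \<in> measurable (\<mu> \<Otimes>\<^sub>M borel) borel"

end

theory Submission
  imports Defs
begin

text \<open>Let \<open>A\<close> be invariant under \<open>S \<times> S\<close>. Its fibre over \<open>(\<omega>, \<omega>')\<close> is the preimage of the fibre over
  \<open>(\<sigma>\<^sup>n \<omega>, \<sigma>\<^sup>n \<omega>')\<close> under the cocycles, hence invariant under translation by
  \<open>ker \<omega>\<^sup>(\<^sup>n\<^sup>)\<close> and \<open>ker \<omega>'\<^sup>(\<^sup>n\<^sup>)\<close>. A character that is trivial on \<open>ker \<omega>\<^sup>(\<^sup>n\<^sup>)\<close> factors through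
  \<open>\<omega>\<^sup>(\<^sup>n\<^sup>)\<close>, so by Fourier tightness only the trivial character is trivial on all these kernels.
  Since characters of a compact abelian group are complete, every fibre has Haar measure 0 or 1,
  and weak mixing of the base decides which of the two happens almost everywhere.

  Completeness of the characters is proved inside the convolution algebra of continuous functions:
  normalised even powers of a self-adjoint element converge uniformly to an idempotent, a nonzero
  idempotent takes a value at least 1 at 0, so minimal ones exist, and the translates of a minimal
  idempotent are its scalar multiples, which makes it a multiple of a character.\<close>

section \<open>Continuous functions on compact products\<close>

text \<open>Nothing in the type class identifies the Borel sigma-algebra of
  \<open>'g \<times> 'g\<close> with the product of the Borel sigma-algebras. Joint measurability of
  continuous functions, on which Fubini for convolutions and averages rests, is therefore obtained
  by uniform approximation. Completeness is proved without compact operators on L2: Cauchy-Schwarz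
  turns L2 estimates for a convolution into uniform ones, so all limits remain continuous functions
  and can be evaluated at 0, where an idempotent shows its squared norm. Completeness is then
  applied to measures, not to expansions of indicator functions. Haar measure conditioned on an
  invariant fibre is still invariant under the kernels; smoothing it with a continuous function
  gives a continuous function whose nontrivial Fourier coefficients vanish, so the conditioned
  measure is Haar measure and the fibre has full measure. Since \<open>A\<close> is strictly
  invariant, its fibres are invariant at every point and no null sets depending on \<open>n\<close>
  have to be controlled.\<close>

lemma continuous_on_prod_measurable:
  fixes F :: "'a::topological_space \<times> 'b::topological_space \<Rightarrow> 'c::metric_space"
  assumes comp: "compact (UNIV :: 'a set)" "compact (UNIV :: 'b set)"
    and F: "continuous_on UNIV F"
  shows "F \<in> borel_measurable (borel \<Otimes>\<^sub>M borel)"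
proof -
  have approx: "\<exists>F'\<in>borel_measurable (borel \<Otimes>\<^sub>M borel). \<forall>p. dist (F' p) (F p) \<le> e" if "e > 0" for e :: real
  proof -
    \<comment> \<open>Tube lemma: compactness of the second factor makes the variation in the first
      variable uniform in \<open>t\<close>.\<close>
    have "\<exists>X0. open X0 \<and> x0 \<in> X0 \<and> (\<forall>x\<in>X0. \<forall>t. dist (F (x, t)) (F (x0, t)) \<le> e)" for x0
      using continuous_on_prod_compactE[of UNIV UNIV F x0 e] F comp that
      by (metis Int_UNIV_right UNIV_I UNIV_Times_UNIV)
    then obtain X where X: "\<And>x0. open (X x0)" "\<And>x0. x0 \<in> X x0"
        "\<And>x0 x t. x \<in> X x0 \<Longrightarrow> dist (F (x, t)) (F (x0, t)) \<le> e"
      by metis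
    obtain D where D: "finite D" "UNIV \<subseteq> (\<Union>d\<in>D. X d)"
      using compactE_image[OF comp(1), of UNIV X] X by (metis UNIV_I UN_I subsetI)
    obtain ds where ds: "set ds = D" using finite_list[OF D(1)] by auto
    define c where "c = (\<lambda>x. LEAST i. i < length ds \<and> x \<in> X (ds ! i))"
    have c: "c x < length ds \<and> x \<in> X (ds ! c x)" for x
    proof -
      obtain d where "d \<in> set ds" "x \<in> X d" using D(2) ds by blast
      then obtain i where "i < length ds \<and> x \<in> X (ds ! i)" by (metis in_set_conv_nth)
      then show ?thesis unfolding c_def by (rule LeastI)
    qed
    have [measurable]: "X d \<in> sets borel" for d using X(1) by auto
    have cm [measurable]: "c \<in> measurable borel (count_space UNIV)"
      unfolding c_def by measurable
    have sec: "(\<lambda>p. F (ds ! i, snd p)) \<in> borel_measurable (borel \<Otimes>\<^sub>M borel)" for i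
    proof -
      have "continuous_on UNIV (\<lambda>y. F (ds ! i, y))"
        by (rule continuous_on_compose2[OF F]) (auto intro!: continuous_intros)
      then have [measurable]: "(\<lambda>y. F (ds ! i, y)) \<in> borel_measurable borel"
        by (rule borel_measurable_continuous_onI)
      show ?thesis by measurable
    qed
    have "(\<lambda>p. F (ds ! c (fst p), snd p)) \<in> borel_measurable (borel \<Otimes>\<^sub>M borel)"
      by (rule measurable_compose_countable'[OF sec, where I = UNIV]) measurable
    moreover have "dist (F (ds ! c (fst p), snd p)) (F p) \<le> e" for p
      using X(3)[of "fst p" "ds ! c (fst p)" "snd p"] c by (simp add: dist_commute)
    ultimately show ?thesis by (intro bexI[of _ "\<lambda>p. F (ds ! c (fst p), snd p)"]) auto
  qed
  have "\<forall>n. \<exists>F'\<in>borel_measurable (borel \<Otimes>\<^sub>M borel). \<forall>p. dist (F' p) (F p) \<le> inverse (real (Suc n))"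
    by (intro allI approx) simp
  then obtain F' where F': "\<And>n. F' n \<in> borel_measurable (borel \<Otimes>\<^sub>M borel)"
      "\<And>n p. dist (F' n p) (F p) \<le> inverse (real (Suc n))"
    by metis
  show ?thesis
  proof (rule borel_measurable_LIMSEQ_metric[OF F'(1)])
    show "(\<lambda>n. F' n p) \<longlonglongrightarrow> F p" for p
      by (rule metric_tendsto_imp_tendsto[OF LIMSEQ_inverse_real_of_nat])
        (use F'(2) in \<open>auto intro!: always_eventually\<close>)
  qed
qed

lemma continuous_on_compact_bounded:
  fixes f :: "'a::topological_space \<Rightarrow> 'b::real_normed_vector"
  assumes "compact (UNIV :: 'a set)" "continuous_on UNIV f"
  obtains B where "B \<ge> 0" "\<And>x. norm (f x) \<le> B"
proof -
  have "bounded (range f)" using assms compact_continuous_image compact_imp_bounded by blast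
  then show ?thesis using that by (metis bounded_pos less_eq_real_def rangeI)
qed

lemma continuous_on_compact_integrable:
  fixes f :: "'a::topological_space \<Rightarrow> 'b::{banach, second_countable_topology}"
  assumes "compact (UNIV :: 'a set)" "continuous_on UNIV f" "finite_measure M" "sets M = sets borel"
  shows "integrable M f"
proof -
  interpret finite_measure M by fact
  obtain B where "\<And>x. norm (f x) \<le> B" using continuous_on_compact_bounded assms(1,2) by metis
  moreover have "f \<in> borel_measurable M"
    using borel_measurable_continuous_onI[OF assms(2)] measurable_cong_sets[OF assms(4) refl] by blast
  ultimately show ?thesis by (intro integrable_const_bound[of f B] AE_I2)
qed

lemma continuous_on_prod_integrable:
  fixes F :: "'a::topological_space \<times> 'b::topological_space \<Rightarrow> 'c::{banach, second_countable_topology}"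
  assumes "compact (UNIV :: 'a set)" "compact (UNIV :: 'b set)" "continuous_on UNIV F"
    and M: "finite_measure M" "sets M = sets borel" and N: "finite_measure N" "sets N = sets borel"
  shows "integrable (M \<Otimes>\<^sub>M N) F"
proof -
  interpret M: finite_measure M by fact
  interpret N: finite_measure N by fact
  interpret P: finite_measure "M \<Otimes>\<^sub>M N"
    using finite_measure_pair_measure[OF N(1) M(1)] .
  have "compact (UNIV :: ('a \<times> 'b) set)"
    using compact_Times[OF assms(1,2)] by simp
  then obtain B where "\<And>x. norm (F x) \<le> B" using continuous_on_compact_bounded assms(3) by metis
  moreover have "F \<in> borel_measurable (M \<Otimes>\<^sub>M N)"
    using continuous_on_prod_measurable[OF assms(1-3)]
      measurable_cong_sets[OF sets_pair_measure_cong[OF M(2) N(2)] refl] by blast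
  ultimately show ?thesis by (intro P.integrable_const_bound[of F B] AE_I2)
qed

text \<open>Dominated convergence handles sequences only, and the parameter space need not be first
  countable. The tube lemma instead bounds the integrand's variation uniformly on a neighbourhood of
  the parameter.\<close>

lemma continuous_on_integral_parameter:
  fixes F :: "'a::topological_space \<times> 'b::topological_space \<Rightarrow> 'c::{banach, second_countable_topology}"
  assumes comp: "compact (UNIV :: 'b set)" and F: "continuous_on UNIV F"
    and M: "finite_measure M" "sets M = sets borel"
  shows "continuous_on UNIV (\<lambda>x. \<integral>y. F (x, y) \<partial>M)"
proof -
  interpret M: finite_measure M by fact
  have int: "integrable M (\<lambda>y. F (x, y))" for x
    by (rule continuous_on_compact_integrable[OF comp _ M])
      (rule continuous_on_compose2[OF F], auto intro!: continuous_intros)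
  have "((\<lambda>x. \<integral>y. F (x, y) \<partial>M) \<longlongrightarrow> (\<integral>y. F (x0, y) \<partial>M)) (at x0)" for x0
  proof (rule tendstoI)
    fix e :: real assume e: "e > 0"
    \<comment> \<open>The summand 1 keeps the denominator positive when \<open>M\<close> has total
      mass 0.\<close>
    define d where "d = e / (measure M (space M) + 1)"
    have "measure M (space M) + 1 > 0" by (simp add: add_nonneg_pos)
    then have d: "d > 0" "d * measure M (space M) < e"
      using e by (auto simp: d_def divide_simps add_nonneg_pos algebra_simps)
    obtain X0 where X0: "x0 \<in> X0" "open X0" "\<And>x t. x \<in> X0 \<Longrightarrow> dist (F (x, t)) (F (x0, t)) \<le> d"
      using continuous_on_prod_compactE[of UNIV UNIV F x0 d] F comp d(1)
      by (metis Int_UNIV_right UNIV_I UNIV_Times_UNIV)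
    have "dist (\<integral>y. F (x, y) \<partial>M) (\<integral>y. F (x0, y) \<partial>M) < e" if "x \<in> X0" for x
    proof -
      have "norm ((\<integral>y. F (x, y) \<partial>M) - (\<integral>y. F (x0, y) \<partial>M)) = norm (\<integral>y. F (x, y) - F (x0, y) \<partial>M)"
        using int by simp
      also have "\<dots> \<le> (\<integral>y. norm (F (x, y) - F (x0, y)) \<partial>M)" by (rule integral_norm_bound)
      also have "\<dots> \<le> (\<integral>y. d \<partial>M)"
        by (intro integral_mono) (use int X0(3)[OF that] in \<open>auto simp: dist_norm\<close>)
      also have "\<dots> < e" using d(2) by (simp add: mult.commute)
      finally show ?thesis by (simp add: dist_norm)
    qed
    then show "\<forall>\<^sub>F x in at x0. dist (\<integral>y. F (x, y) \<partial>M) (\<integral>y. F (x0, y) \<partial>M) < e"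
      using X0(1,2) eventually_at_topological by blast
  qed
  then show ?thesis by (simp add: continuous_on_def)
qed

lemma compact_Urysohn:
  fixes K U :: "'a::t2_space set"
  assumes "compact (UNIV :: 'a set)" "closed K" "open U" "K \<subseteq> U"
  obtains f :: "'a \<Rightarrow> real" where "continuous_on UNIV f" "\<And>x. 0 \<le> f x" "\<And>x. f x \<le> 1"
    "\<And>x. x \<in> K \<Longrightarrow> f x = 1" "\<And>x. x \<notin> U \<Longrightarrow> f x = 0"
proof -
  have "Hausdorff_space (euclidean :: 'a topology)"
    unfolding Hausdorff_space_def disjnt_def using hausdorff by (metis open_openin)
  moreover have "compact_space (euclidean :: 'a topology)"
    using assms(1) by (simp add: compact_space_def)
  ultimately have "normal_space (euclidean :: 'a topology)"
    by (simp add: compact_Hausdorff_or_regular_imp_normal_space)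
  moreover have "closedin euclidean (- U)" "closedin euclidean K" "disjnt (- U) K"
    using assms by (auto simp: disjnt_def)
  ultimately obtain f :: "'a \<Rightarrow> real" where f: "continuous_map euclidean (top_of_set {0..1}) f"
      "f ` (- U) \<subseteq> {0}" "f ` K \<subseteq> {1}"
    by (rule Urysohn_lemma[of euclidean "- U" K 0 1]) simp
  have "continuous_on UNIV f" "range f \<subseteq> {0..1}"
    using f(1) by (auto simp: continuous_map_in_subtopology)
  then have "continuous_on UNIV f" "0 \<le> f x" "f x \<le> 1" for x by (auto simp: image_subset_iff)
  moreover have "f x = 1" if "x \<in> K" for x using f(3) that by blast
  moreover have "f x = 0" if "x \<notin> U" for x using f(2) that by blast
  ultimately show ?thesis by (rule that)
qed

section \<open>Haar measure\<close>

text \<open>The regularity clause of \<open>haar_probability\<close>, isolated because it has to be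
  checked again for image measures and for conditioned measures.\<close>

definition compact_regular :: "'a::topological_space measure \<Rightarrow> bool" where
  "compact_regular M \<longleftrightarrow>
     (\<forall>A\<in>sets M. emeasure M A = (SUP K\<in>{K. K \<subseteq> A \<and> compact K}. emeasure M K))"

lemma compact_regularI:
  fixes M :: "'a::t2_space measure"
  assumes sets: "sets M = sets borel"
    and le: "\<And>A. A \<in> sets borel \<Longrightarrow> emeasure M A \<le> (SUP K\<in>{K. K \<subseteq> A \<and> compact K}. emeasure M K)"
  shows "compact_regular M"
  unfolding compact_regular_def
proof
  fix A assume "A \<in> sets M"
  then show "emeasure M A = (SUP K\<in>{K. K \<subseteq> A \<and> compact K}. emeasure M K)"
    using le[of A] sets by (intro antisym SUP_least emeasure_mono) auto
qed

text \<open>This is one half of the uniqueness in the Riesz representation theorem. For compact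
  \<open>K\<close>, regularity of \<open>m\<close> gives a compact \<open>L\<close> exhausting
  \<open>- K\<close> up to \<open>e\<close>, and a Urysohn function between the indicators of
  \<open>K\<close> and \<open>- L\<close> compares the two measures. Regularity of
  \<open>\<nu>\<close> passes from compact sets to \<open>A\<close>.\<close>

lemma regular_measure_le_of_integral_eq:
  fixes \<nu> m :: "'a::t2_space measure"
  assumes comp: "compact (UNIV :: 'a set)"
    and m: "finite_measure m" "sets m = sets borel" and \<nu>: "finite_measure \<nu>" "sets \<nu> = sets borel"
    and regm: "compact_regular m" and reg\<nu>: "compact_regular \<nu>"
    and eq: "\<And>f::'a \<Rightarrow> real. continuous_on UNIV f \<Longrightarrow> (\<integral>x. f x \<partial>\<nu>) = (\<integral>x. f x \<partial>m)"
    and A: "A \<in> sets borel"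
  shows "emeasure \<nu> A \<le> emeasure m A"
proof -
  interpret m: finite_measure m by fact
  interpret nu: finite_measure \<nu> by fact
  have cl: "closed K \<longleftrightarrow> compact K" for K :: "'a set"
    using comp compact_imp_closed closed_Int_compact[of K UNIV] by auto
  have K: "emeasure \<nu> K \<le> emeasure m K" if K: "compact K" for K
  proof -
    have Kb: "K \<in> sets borel" using K cl by auto
    have outer: "measure \<nu> K \<le> measure m K + e" if e: "e > 0" for e
    proof -
      have "emeasure m (- K) = (SUP L\<in>{L. L \<subseteq> - K \<and> compact L}. emeasure m L)"
        using regm Kb m(2) by (auto simp: compact_regular_def)
      moreover have "\<exists>L. L \<subseteq> - K \<and> compact L \<and> measure m L > measure m (- K) - e"
      proof (rule ccontr)
        assume *: "\<not> ?thesis"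
        have "emeasure m L \<le> ennreal (measure m (- K) - e)" if "L \<subseteq> - K \<and> compact L" for L
          using * that by (auto simp: m.emeasure_eq_measure intro!: ennreal_leI)
        then have "emeasure m (- K) \<le> ennreal (measure m (- K) - e)"
          using calculation by (auto intro!: SUP_least)
        \<comment> \<open>The empty set is among the candidates for \<open>L\<close>. Nonnegativity
          matters because \<open>ennreal\<close> truncates negative numbers to 0.\<close>
        moreover have "measure m (- K) - e \<ge> 0"
          using *[simplified, rule_format, of "{}"] by simp
        ultimately show False using e by (simp add: m.emeasure_eq_measure)
      qed
      ultimately obtain L where L: "L \<subseteq> - K" "compact L" "measure m L > measure m (- K) - e" by blast
      obtain f where f: "continuous_on UNIV f" "\<And>x. 0 \<le> f x" "\<And>x. f x \<le> (1::real)"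
        "\<And>x. x \<in> K \<Longrightarrow> f x = 1" "\<And>x. x \<notin> - L \<Longrightarrow> f x = 0"
        using compact_Urysohn[OF comp, of K "- L"] K L cl by (metis compl_le_swap1 open_Compl)
      have int: "integrable M f" if "finite_measure M" "sets M = sets borel" for M
        using continuous_on_compact_integrable[OF comp f(1) that] .
      have Lb: "L \<in> sets borel" using L cl by auto
      have ind\<nu>: "integrable \<nu> (indicator K :: 'a \<Rightarrow> real)"
        using Kb \<nu>(2) by (simp add: integrable_indicator_iff nu.emeasure_eq_measure)
      have indm: "integrable m (indicator (- L) :: 'a \<Rightarrow> real)"
        using Lb m(2) by (simp add: integrable_indicator_iff m.emeasure_eq_measure)
      have "measure \<nu> K = (\<integral>x. indicator K x \<partial>\<nu>)" using Kb \<nu>(2) by simp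
      also have "\<dots> \<le> (\<integral>x. f x \<partial>\<nu>)"
        by (intro integral_mono int \<nu> ind\<nu>) (use f in \<open>auto simp: indicator_def\<close>)
      also have "\<dots> = (\<integral>x. f x \<partial>m)" by (rule eq[OF f(1)])
      also have "\<dots> \<le> (\<integral>x. indicator (- L) x \<partial>m)"
        by (intro integral_mono int m indm) (use f in \<open>auto simp: indicator_def\<close>)
      also have "\<dots> = measure m (- L)" using Lb m(2) by simp
      also have "\<dots> = measure m UNIV - measure m L"
        using m.finite_measure_compl[of L] Lb m(2) sets_eq_imp_space_eq[OF m(2)] by (simp add: Compl_eq_Diff_UNIV)
      also have "\<dots> \<le> measure m UNIV - (measure m (- K) - e)" using L by simp
      also have "measure m (- K) = measure m UNIV - measure m K"
        using m.finite_measure_compl[of K] Kb m(2) sets_eq_imp_space_eq[OF m(2)] by (simp add: Compl_eq_Diff_UNIV)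
      finally show ?thesis by simp
    qed
    have "measure \<nu> K \<le> measure m K" by (rule field_le_epsilon) (rule outer)
    then show ?thesis
      unfolding m.emeasure_eq_measure nu.emeasure_eq_measure by (rule ennreal_leI)
  qed
  have "emeasure \<nu> A = (SUP K\<in>{K. K \<subseteq> A \<and> compact K}. emeasure \<nu> K)" using reg\<nu> A \<nu>(2) by (auto simp: compact_regular_def)
  also have "\<dots> \<le> (SUP K\<in>{K. K \<subseteq> A \<and> compact K}. emeasure m K)"
    using K by (intro SUP_mono) auto
  also have "\<dots> = emeasure m A" using regm A m(2) by (auto simp: compact_regular_def)
  finally show ?thesis .
qed

lemma regular_measure_eqI:
  fixes \<nu> m :: "'a::t2_space measure"
  assumes comp: "compact (UNIV :: 'a set)"
    and m: "finite_measure m" "sets m = sets borel" and \<nu>: "finite_measure \<nu>" "sets \<nu> = sets borel"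
    and reg: "compact_regular m" "compact_regular \<nu>"
    and eq: "\<And>f::'a \<Rightarrow> real. continuous_on UNIV f \<Longrightarrow> (\<integral>x. f x \<partial>\<nu>) = (\<integral>x. f x \<partial>m)"
  shows "\<nu> = m"
proof (rule measure_eqI)
  fix A assume "A \<in> sets \<nu>"
  then have A: "A \<in> sets borel" using \<nu>(2) by simp
  show "emeasure \<nu> A = emeasure m A"
    using regular_measure_le_of_integral_eq[OF comp m \<nu> reg eq A]
      regular_measure_le_of_integral_eq[OF comp \<nu> m reg(2,1) eq[symmetric] A]
    by (rule antisym)
qed (simp add: m(2) \<nu>(2))


section \<open>Haar measure under translations, epimorphisms and inversion\<close>

locale compact_haar_group = prob_space m for m :: "'g::{topological_ab_group_add, t2_space} measure" +
  assumes compact_UNIV: "compact (UNIV :: 'g set)"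
    and haar: "haar_probability m"
begin

lemma sets_m [simp, measurable_cong]: "sets m = sets borel"
  using haar by (simp add: haar_probability_def)

lemma space_m [simp]: "space m = UNIV"
  using sets_eq_imp_space_eq[OF sets_m] by simp

lemma emeasure_UNIV [simp]: "emeasure m UNIV = 1"
  using emeasure_space_1 by simp

lemma prob_UNIV [simp]: "measure m UNIV = 1"
  using prob_space by simp

lemma regular: "compact_regular m"
  using haar by (simp add: haar_probability_def compact_regular_def)

lemma continuous_on_measurable [measurable_dest]:
  "continuous_on UNIV f \<Longrightarrow> f \<in> borel_measurable m"
  using borel_measurable_continuous_onI by (simp add: measurable_cong_sets[OF sets_m refl])

lemma continuous_on_measurable_endo: "continuous_on UNIV f \<Longrightarrow> f \<in> measurable m m"
  using borel_measurable_continuous_onI by (simp add: measurable_cong_sets[OF sets_m sets_m])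

lemma continuous_translation: "continuous_on UNIV (\<lambda>x::'g. a + x)"
  by (intro continuous_intros)

lemma integrable_continuous:
  fixes f :: "'g \<Rightarrow> 'b::{banach, second_countable_topology}"
  shows "continuous_on UNIV f \<Longrightarrow> integrable m f"
  using continuous_on_compact_integrable[OF compact_UNIV _ finite_measure_axioms sets_m] .

lemma integrable_continuous_prod:
  fixes F :: "'g \<times> 'g \<Rightarrow> 'b::{banach, second_countable_topology}"
  shows "continuous_on UNIV F \<Longrightarrow> integrable (m \<Otimes>\<^sub>M m) F"
  using continuous_on_prod_integrable[OF compact_UNIV compact_UNIV _ finite_measure_axioms sets_m
      finite_measure_axioms sets_m] .

lemma integral_translation:
  fixes f :: "'g \<Rightarrow> 'b::{banach, second_countable_topology}"
  assumes "f \<in> borel_measurable m"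
  shows "(\<integral>x. f (a + x) \<partial>m) = (\<integral>x. f x \<partial>m)"
proof -
  have "(\<integral>x. f x \<partial>m) = (\<integral>x. f x \<partial>distr m m (\<lambda>x. a + x))"
    using haar by (simp add: haar_probability_def)
  also have "\<dots> = (\<integral>x. f (a + x) \<partial>m)"
    by (rule integral_distr[OF continuous_on_measurable_endo[OF continuous_translation] assms])
  finally show ?thesis ..
qed

lemma emeasure_translation:
  assumes "A \<in> sets borel"
  shows "emeasure m {x. a + x \<in> A} = emeasure m A"
proof -
  have "emeasure m A = emeasure (distr m m (\<lambda>x. a + x)) A"
    using haar by (simp add: haar_probability_def)
  also have "\<dots> = emeasure m {x. a + x \<in> A}"
    using assms by (subst emeasure_distr)
      (auto intro!: continuous_on_measurable_endo continuous_translation simp: vimage_def)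
  finally show ?thesis ..
qed

text \<open>The double integral of \<open>f (y + x)\<close> over \<open>m\<close> and
  \<open>\<nu>\<close> is evaluated in both orders: invariance of \<open>\<nu>\<close> makes the
  inner integral constant in one order, invariance of \<open>m\<close> in the other.\<close>

lemma integral_eq_of_invariant:
  fixes f :: "'g \<Rightarrow> 'b::{banach, second_countable_topology}"
  assumes \<nu>: "prob_space \<nu>" "sets \<nu> = sets borel" and inv: "\<And>a. distr \<nu> \<nu> (\<lambda>x. a + x) = \<nu>"
    and f: "continuous_on UNIV f"
  shows "(\<integral>x. f x \<partial>\<nu>) = (\<integral>x. f x \<partial>m)"
proof -
  interpret nu: prob_space \<nu> by fact
  interpret P: pair_sigma_finite m \<nu> ..
  have F: "continuous_on UNIV (\<lambda>(y, x). f (y + x))"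
    unfolding split_beta by (rule continuous_on_compose2[OF f]) (auto intro!: continuous_intros)
  have int: "integrable (m \<Otimes>\<^sub>M \<nu>) (\<lambda>(y, x). f (y + x))"
    by (rule continuous_on_prod_integrable[OF compact_UNIV compact_UNIV F finite_measure_axioms sets_m
      nu.finite_measure_axioms \<nu>(2)])
  have fm: "f \<in> borel_measurable \<nu>"
    using borel_measurable_continuous_onI[OF f] by (simp add: measurable_cong_sets[OF \<nu>(2) refl])
  have tm: "(\<lambda>x. a + x) \<in> measurable \<nu> \<nu>" for a
    using borel_measurable_continuous_onI[OF continuous_translation]
    by (simp add: measurable_cong_sets[OF \<nu>(2) \<nu>(2)])
  have "(\<integral>x. f (a + x) \<partial>\<nu>) = (\<integral>x. f x \<partial>\<nu>)" for a
    using integral_distr[OF tm fm, of a] by (simp add: inv)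
  then have "(\<integral>x. f x \<partial>\<nu>) = (\<integral>y. (\<integral>x. f (y + x) \<partial>\<nu>) \<partial>m)"
    by simp
  also have "\<dots> = (\<integral>x. (\<integral>y. f (y + x) \<partial>m) \<partial>\<nu>)"
    using P.Fubini_integral[OF int] by simp
  also have "\<dots> = (\<integral>x. (\<integral>y. f y \<partial>m) \<partial>\<nu>)"
    using integral_translation[OF continuous_on_measurable[OF f]] by (simp add: add.commute)
  also have "\<dots> = (\<integral>x. f x \<partial>m)"
    using nu.prob_space by simp
  finally show ?thesis .
qed

text \<open>Uniqueness of Haar measure applies to the image measure. It is invariant because
  surjectivity writes each translation vector as \<open>\<tau> b\<close>, and regular because
  continuous images of compact sets are compact.\<close>

lemma distr_Epi:
  assumes "\<tau> \<in> Epi"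
  shows "distr m m \<tau> = m"
proof -
  have \<tau>: "continuous_on UNIV \<tau>" "\<And>x y. \<tau> (x + y) = \<tau> x + \<tau> y" "surj \<tau>"
    using assms by (auto simp: Epi_def Modules.additive_def)
  have \<tau>m [measurable]: "\<tau> \<in> measurable m m" by (rule continuous_on_measurable_endo[OF \<tau>(1)])
  let ?\<nu> = "distr m m \<tau>"
  have \<nu>: "prob_space ?\<nu>" by (rule prob_space_distr[OF \<tau>m])
  have sets\<nu>: "sets ?\<nu> = sets borel" by simp
  have tm [measurable]: "(\<lambda>x. a + x) \<in> measurable m m" for a
    by (rule continuous_on_measurable_endo[OF continuous_translation])
  have inv: "distr ?\<nu> ?\<nu> (\<lambda>x. a + x) = ?\<nu>" for a
  proof -
    obtain b where b: "a = \<tau> b" using \<tau>(3) by auto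
    have "distr ?\<nu> ?\<nu> (\<lambda>x. a + x) = distr ?\<nu> m (\<lambda>x. a + x)" by (rule distr_cong) auto
    also have "\<dots> = distr m m (\<lambda>x. a + \<tau> x)" by (subst distr_distr) (auto simp: o_def)
    also have "\<dots> = distr m m (\<lambda>x. \<tau> (b + x))" by (simp add: b \<tau>(2))
    also have "\<dots> = distr (distr m m (\<lambda>x. b + x)) m \<tau>" by (subst distr_distr) (auto simp: o_def)
    also have "\<dots> = ?\<nu>" using haar by (simp add: haar_probability_def)
    finally show ?thesis .
  qed
  have reg: "compact_regular ?\<nu>"
  proof (rule compact_regularI[OF sets\<nu>])
    fix A :: "'g set" assume "A \<in> sets borel"
    then have A: "A \<in> sets m" by simp
    have A': "\<tau> -` A \<in> sets m" using measurable_sets[OF \<tau>m A] by simp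
    have "emeasure ?\<nu> A = emeasure m (\<tau> -` A)" using A by (simp add: emeasure_distr)
    also have "\<dots> = (SUP K\<in>{K. K \<subseteq> \<tau> -` A \<and> compact K}. emeasure m K)"
      using regular A' unfolding compact_regular_def by blast
    also have "\<dots> \<le> (SUP K\<in>{K. K \<subseteq> A \<and> compact K}. emeasure ?\<nu> K)"
    proof (rule SUP_mono)
      fix K assume K: "K \<in> {K. K \<subseteq> \<tau> -` A \<and> compact K}"
      have cK: "compact (\<tau> ` K)"
        using K compact_continuous_image continuous_on_subset[OF \<tau>(1)] by auto
      then have "\<tau> ` K \<in> sets borel" by (intro borel_closed compact_imp_closed)
      then have "emeasure ?\<nu> (\<tau> ` K) = emeasure m (\<tau> -` \<tau> ` K)" by (simp add: emeasure_distr)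
      moreover have "\<tau> -` \<tau> ` K \<in> sets m" using \<open>\<tau> ` K \<in> sets borel\<close> measurable_sets[OF \<tau>m] by simp
      ultimately have "emeasure m K \<le> emeasure ?\<nu> (\<tau> ` K)"
        using emeasure_mono[of K "\<tau> -` \<tau> ` K" m] by auto
      then show "\<exists>L\<in>{K. K \<subseteq> A \<and> compact K}. emeasure m K \<le> emeasure ?\<nu> L"
        using cK K by (intro bexI[of _ "\<tau> ` K"]) auto
    qed
    finally show "emeasure ?\<nu> A \<le> (SUP K\<in>{K. K \<subseteq> A \<and> compact K}. emeasure ?\<nu> K)" .
  qed
  have fin: "finite_measure ?\<nu>" using \<nu> by (simp add: prob_space_def)
  show ?thesis
    by (rule regular_measure_eqI[OF compact_UNIV finite_measure_axioms sets_m fin sets\<nu> regular reg])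
      (rule integral_eq_of_invariant[OF \<nu> sets\<nu> inv])
qed

lemma emeasure_Epi:
  assumes "\<tau> \<in> Epi" "A \<in> sets borel"
  shows "emeasure m {x. \<tau> x \<in> A} = emeasure m A"
proof -
  have "\<tau> \<in> measurable m m" using assms by (auto simp: Epi_def intro: continuous_on_measurable_endo)
  then have "emeasure (distr m m \<tau>) A = emeasure m {x. \<tau> x \<in> A}"
    using assms(2) by (subst emeasure_distr) (auto simp: vimage_def)
  then show ?thesis by (simp add: distr_Epi[OF assms(1)])
qed

text \<open>Inversion in an abelian group is itself an epimorphism.\<close>

lemma integral_uminus:
  fixes f :: "'g \<Rightarrow> 'b::{banach, second_countable_topology}"
  assumes "f \<in> borel_measurable m"
  shows "(\<integral>x. f (- x) \<partial>m) = (\<integral>x. f x \<partial>m)"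
proof -
  have "continuous_on UNIV (\<lambda>x::'g. - x)" by (rule continuous_on_minus[OF continuous_on_id])
  moreover have "surj (\<lambda>x::'g. - x)" by (rule surjI[of _ uminus]) simp
  ultimately have "(\<lambda>x::'g. - x) \<in> Epi" by (simp add: Epi_def Modules.additive_def)
  then have "distr m m (\<lambda>x. - x) = m" by (rule distr_Epi)
  then have "(\<integral>x. f x \<partial>m) = (\<integral>x. f x \<partial>distr m m (\<lambda>x. - x))" by simp
  also have "\<dots> = (\<integral>x. f (- x) \<partial>m)"
    by (rule integral_distr[OF continuous_on_measurable_endo assms]) fact
  finally show ?thesis ..
qed

text \<open>A nonempty open set is never null: by compactness finitely many of its translates cover
  the group.\<close>

lemma continuous_nonneg_integral_eq_0:
  fixes f :: "'g \<Rightarrow> real"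
  assumes f: "continuous_on UNIV f" "\<And>x. 0 \<le> f x" and int: "(\<integral>x. f x \<partial>m) = 0"
  shows "f x = 0"
proof (rule ccontr)
  assume "f x \<noteq> 0"
  define U where "U = {y. f y > 0}"
  have U: "open U" "x \<in> U"
    unfolding U_def using \<open>f x \<noteq> 0\<close> f(2)[of x]
    by (auto intro!: open_Collect_less continuous_on_const f(1))
  have "AE y in m. f y = 0"
    using integral_nonneg_eq_0_iff_AE[OF integrable_continuous[OF f(1)]] f(2) int by simp
  then have "AE y in m. y \<notin> U" by eventually_elim (simp add: U_def)
  then have nullU: "emeasure m U = 0"
    using U(1) AE_iff_measurable[of U m "\<lambda>y. y \<notin> U"] by simp
  define V where "V = (\<lambda>a. {y. a + y \<in> U})"
  have oV: "open (V a)" for a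
    using open_vimage[OF U(1) continuous_translation] by (simp add: V_def vimage_def)
  have "y \<in> V (x - y)" for y using U(2) by (simp add: V_def)
  then obtain D where D: "finite D" "UNIV \<subseteq> (\<Union>a\<in>D. V a)"
    using compactE_image[OF compact_UNIV, of UNIV V] oV by (metis UNIV_I UN_I subsetI)
  have "emeasure m UNIV \<le> emeasure m (\<Union>a\<in>D. V a)"
    using D oV by (intro emeasure_mono) auto
  also have "\<dots> \<le> (\<Sum>a\<in>D. emeasure m (V a))"
    using oV by (intro emeasure_subadditive_finite D) auto
  also have "\<dots> = 0"
    using emeasure_translation[of U] U(1) nullU by (simp add: V_def)
  finally show False by simp
qed

end

section \<open>Convolution of continuous functions\<close>

text \<open>Applied to the squared L2 norms \<open>c k\<close> of the convolution powers with
  \<open>k + 1\<close> factors. Log-convexity makes the ratios \<open>r k\<close> increase and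
  submultiplicativity bounds them by \<open>c 0\<close>, so they have a limit \<open>l\<close>.
  Since \<open>r k \<le> l\<close>, the normalised sequence decreases; the bound
  \<open>d \<ge> 1\<close> is what later prevents the limiting idempotent from vanishing.\<close>

lemma log_convex_submultiplicative_limit:
  fixes c :: "nat \<Rightarrow> real"
  assumes pos: "\<And>k. c k > 0"
    and convex: "\<And>k. (c (Suc k))\<^sup>2 \<le> c k * c (Suc (Suc k))"
    and submult: "\<And>j k. c (Suc (j + k)) \<le> c j * c k"
  obtains l d where "l > 0" "d \<ge> 1" "(\<lambda>k. c k / l ^ Suc k) \<longlonglongrightarrow> d"
proof -
  define r where "r k = c (Suc k) / c k" for k
  have c_Suc: "c (Suc k) = r k * c k" for k using pos[of k] by (simp add: r_def)
  have r_pos: "r k > 0" for k using pos by (simp add: r_def)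
  have "incseq r"
    using convex pos by (intro incseq_SucI) (simp add: r_def divide_simps power2_eq_square mult.commute)
  moreover have "r k \<le> c 0" for k using submult[of 0 k] pos[of k] by (simp add: r_def divide_simps)
  ultimately obtain l where l: "r \<longlonglongrightarrow> l" "\<And>k. r k \<le> l"
    by (metis incseq_convergent)
  have l_pos: "l > 0" using r_pos[of 0] l(2)[of 0] by linarith
  define b where "b k = c k / l ^ Suc k" for k
  have "decseq b"
  proof (rule decseq_SucI)
    fix k
    have "c (Suc k) \<le> l * c k" using l(2)[of k] pos[of k] by (simp add: c_Suc)
    then have "c (Suc k) / l ^ Suc (Suc k) \<le> (l * c k) / l ^ Suc (Suc k)"
      by (rule divide_right_mono) (use l_pos in simp)
    then show "b (Suc k) \<le> b k" using l_pos by (simp add: b_def)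
  qed
  moreover have b_ge: "b j \<ge> 1" for j
  proof -
    \<comment> \<open>The quotient is a product of \<open>j + 1\<close> consecutive ratios, each
      tending to \<open>l\<close>, and submultiplicativity bounds it by \<open>c j\<close>. Hence
      \<open>l ^ Suc j \<le> c j\<close>.\<close>
    have "(\<lambda>k. c (Suc (j + k)) / c k) \<longlonglongrightarrow> l ^ Suc j"
    proof (induction j)
      case 0
      then show ?case using l(1) by (simp add: r_def[abs_def])
    next
      case (Suc j)
      have "(\<lambda>k. r (Suc j + k)) \<longlonglongrightarrow> l" using LIMSEQ_ignore_initial_segment[OF l(1), of "Suc j"]
        by (simp add: add.commute)
      from tendsto_mult[OF this Suc] show ?case by (simp add: c_Suc)
    qed
    moreover have "c (Suc (j + k)) / c k \<le> c j" for k
      using submult[of j k] pos[of k] by (simp add: divide_simps)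
    ultimately have "l ^ Suc j \<le> c j" by (intro LIMSEQ_le_const2) auto
    then show ?thesis using l_pos by (simp add: b_def divide_simps)
  qed
  ultimately obtain d where d: "b \<longlonglongrightarrow> d" by (metis decseq_convergent)
  then have "d \<ge> 1" using b_ge by (intro LIMSEQ_le_const) auto
  then show ?thesis using that[of l d] l_pos d by (simp add: b_def[abs_def])
qed

context compact_haar_group
begin

definition conv :: "('g \<Rightarrow> complex) \<Rightarrow> ('g \<Rightarrow> complex) \<Rightarrow> 'g \<Rightarrow> complex" where
  "conv f g x = (\<integral>y. f (x - y) * g y \<partial>m)"

text \<open>The involution of the group algebra: \<open>star u = u\<close> says that convolution by
  \<open>u\<close> is a self-adjoint operator.\<close>

definition star :: "('g \<Rightarrow> complex) \<Rightarrow> 'g \<Rightarrow> complex" where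
  "star f x = cnj (f (- x))"

definition sq_norm :: "('g \<Rightarrow> complex) \<Rightarrow> real" where
  "sq_norm f = (\<integral>x. (cmod (f x))\<^sup>2 \<partial>m)"

lemma continuous_compose_diff:
  assumes "continuous_on UNIV (f :: 'g \<Rightarrow> 'b::topological_space)"
  shows "continuous_on UNIV (\<lambda>y. f (x - y))"
  by (rule continuous_on_compose2[OF assms continuous_on_diff[OF continuous_on_const continuous_on_id]]) simp

lemma continuous_conv_integrand:
  fixes f g :: "'g \<Rightarrow> complex"
  assumes "continuous_on UNIV f" "continuous_on UNIV g"
  shows "continuous_on UNIV (\<lambda>y. f (x - y) * g y)"
  using assms by (intro continuous_on_mult continuous_compose_diff)

lemma integrable_conv:
  fixes f g :: "'g \<Rightarrow> complex"
  assumes "continuous_on UNIV f" "continuous_on UNIV g"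
  shows "integrable m (\<lambda>y. f (x - y) * g y)"
  using assms by (intro integrable_continuous continuous_conv_integrand)

lemma continuous_conv [continuous_intros]:
  assumes f: "continuous_on UNIV f" and g: "continuous_on UNIV g"
  shows "continuous_on UNIV (conv f g)"
proof -
  have "continuous_on UNIV (\<lambda>p::'g \<times> 'g. f (fst p - snd p))"
    by (rule continuous_on_compose2[OF f continuous_on_diff[OF continuous_on_fst continuous_on_snd]])
      (auto intro: continuous_on_id)
  moreover have "continuous_on UNIV (\<lambda>p::'g \<times> 'g. g (snd p))"
    by (rule continuous_on_compose2[OF g continuous_on_snd]) (auto intro: continuous_on_id)
  ultimately have "continuous_on UNIV (\<lambda>p. f (fst p - snd p) * g (snd p))"
    by (rule continuous_on_mult)
  from continuous_on_integral_parameter[OF compact_UNIV this finite_measure_axioms sets_m]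
  show ?thesis by (simp add: conv_def[abs_def])
qed

lemma continuous_star [continuous_intros]:
  assumes f: "continuous_on UNIV f"
  shows "continuous_on UNIV (star f)"
proof -
  have "continuous_on UNIV (\<lambda>x. f (- x))"
    by (rule continuous_on_compose2[OF f continuous_on_minus[OF continuous_on_id]]) simp
  then show ?thesis unfolding star_def[abs_def] by (rule continuous_on_cnj)
qed

lemma conv_commute:
  assumes f: "continuous_on UNIV f" and g: "continuous_on UNIV g"
  shows "conv f g = conv g f"
proof
  fix x
  have c: "continuous_on UNIV (\<lambda>y. f (x - y) * g y)" by (rule continuous_conv_integrand[OF f g])
  have c': "continuous_on UNIV (\<lambda>y. f (x + y) * g (- y))"
    using continuous_on_compose2[OF c continuous_on_minus[OF continuous_on_id]] by simp
  have "conv f g x = (\<integral>y. f (x + y) * g (- y) \<partial>m)"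
    using integral_uminus[OF continuous_on_measurable[OF c]] by (simp add: conv_def)
  also have "\<dots> = (\<integral>y. f (x + (- x + y)) * g (- (- x + y)) \<partial>m)"
    using integral_translation[OF continuous_on_measurable[OF c'], of "- x"] by simp
  also have "\<dots> = conv g f x" by (simp add: conv_def mult.commute)
  finally show "conv f g x = conv g f x" .
qed

lemma conv_assoc:
  assumes f: "continuous_on UNIV f" and g: "continuous_on UNIV g" and h: "continuous_on UNIV h"
  shows "conv (conv f g) h = conv f (conv g h)"
proof
  fix x
  interpret P: pair_sigma_finite m m ..
  let ?F = "\<lambda>(w, y). f (x - w) * (g (w - y) * h y)"
  have "continuous_on UNIV (\<lambda>p::'g \<times> 'g. g (fst p - snd p))"
    by (rule continuous_on_compose2[OF g continuous_on_diff[OF continuous_on_fst continuous_on_snd]])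
      (auto intro: continuous_on_id)
  moreover have "continuous_on UNIV (\<lambda>p::'g \<times> 'g. h (snd p))"
    by (rule continuous_on_compose2[OF h continuous_on_snd]) (auto intro: continuous_on_id)
  moreover have "continuous_on UNIV (\<lambda>p::'g \<times> 'g. f (x - fst p))"
    by (rule continuous_on_compose2[OF f continuous_on_diff[OF continuous_on_const continuous_on_fst]])
      (auto intro: continuous_on_id)
  ultimately have "continuous_on UNIV ?F"
    unfolding split_beta by (intro continuous_on_mult)
  then have int: "integrable (m \<Otimes>\<^sub>M m) ?F" by (rule integrable_continuous_prod)
  have inner: "(\<integral>w. f (x - w) * (g (w - y) * h y) \<partial>m) = conv f g (x - y) * h y" for y
  proof -
    have "continuous_on UNIV (\<lambda>w. g (w - y))"
      by (rule continuous_on_compose2[OF g continuous_on_diff[OF continuous_on_id continuous_on_const]]) simp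
    then have c: "continuous_on UNIV (\<lambda>w. f (x - w) * g (w - y))"
      by (intro continuous_on_mult continuous_compose_diff f)
    have "(\<integral>w. f (x - w) * (g (w - y) * h y) \<partial>m) = (\<integral>w. f (x - w) * g (w - y) \<partial>m) * h y"
      by (simp add: mult.assoc[symmetric])
    also have "(\<integral>w. f (x - w) * g (w - y) \<partial>m) = (\<integral>w. f (x - (y + w)) * g (y + w - y) \<partial>m)"
      using integral_translation[OF continuous_on_measurable[OF c], of y] by simp
    also have "\<dots> = conv f g (x - y)" by (simp add: conv_def diff_diff_eq)
    finally show ?thesis .
  qed
  have "conv (conv f g) h x = (\<integral>y. (\<integral>w. f (x - w) * (g (w - y) * h y) \<partial>m) \<partial>m)"
    by (simp only: inner) (simp add: conv_def)
  also have "\<dots> = (\<integral>w. (\<integral>y. f (x - w) * (g (w - y) * h y) \<partial>m) \<partial>m)"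
    using P.Fubini_integral[OF int] by simp
  also have "\<dots> = conv f (conv g h) x" by (simp add: conv_def)
  finally show "conv (conv f g) h x = conv f (conv g h) x" .
qed

lemma conv_diff_left:
  assumes "continuous_on UNIV f" "continuous_on UNIV g" "continuous_on UNIV h"
  shows "conv (\<lambda>x. f x - g x) h = (\<lambda>x. conv f h x - conv g h x)"
  using integrable_conv assms by (auto simp: conv_def left_diff_distrib)

lemma conv_scale_left: "conv (\<lambda>x. a * f x) g = (\<lambda>x. a * conv f g x)"
  by (auto simp: conv_def mult.assoc)

lemma conv_scale_right: "conv f (\<lambda>x. a * g x) = (\<lambda>x. a * conv f g x)"
  by (auto simp: conv_def mult.left_commute)

lemma conv_diff_right:
  assumes "continuous_on UNIV f" "continuous_on UNIV g" "continuous_on UNIV h"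
  shows "conv h (\<lambda>x. f x - g x) = (\<lambda>x. conv h f x - conv h g x)"
  using integrable_conv assms by (auto simp: conv_def right_diff_distrib)

lemma conv_add_right:
  assumes "continuous_on UNIV f" "continuous_on UNIV g" "continuous_on UNIV h"
  shows "conv h (\<lambda>x. f x + g x) = (\<lambda>x. conv h f x + conv h g x)"
  using integrable_conv assms by (auto simp: conv_def distrib_left)

lemma star_star [simp]: "star (star f) = f"
  by (auto simp: star_def)

lemma star_conv:
  assumes f: "continuous_on UNIV f" and g: "continuous_on UNIV g"
  shows "star (conv f g) = conv (star f) (star g)"
proof
  fix x
  have c: "continuous_on UNIV (\<lambda>y. cnj (f (- x - y) * g y))"
    by (intro continuous_on_cnj continuous_conv_integrand f g)
  have "star (conv f g) x = (\<integral>y. cnj (f (- x - y) * g y) \<partial>m)" by (simp add: star_def conv_def del: complex_cnj_mult)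
  also have "\<dots> = (\<integral>y. cnj (f (- x - (- y)) * g (- y)) \<partial>m)"
    using integral_uminus[OF continuous_on_measurable[OF c]] by simp
  also have "\<dots> = conv (star f) (star g) x" by (simp add: conv_def star_def minus_diff_commute)
  finally show "star (conv f g) x = conv (star f) (star g) x" .
qed

section \<open>Evaluation at 0, the L2 norm and the Cauchy-Schwarz bound\<close>

lemma sq_norm_nonneg: "sq_norm f \<ge> 0"
  by (simp add: sq_norm_def)

text \<open>Evaluation at 0 plays the role of the inner product: for self-adjoint elements, squared
  norms are read off from convolution squares at 0.\<close>

lemma conv_star_self_0:
  assumes f: "continuous_on UNIV f"
  shows "conv f (star f) 0 = of_real (sq_norm f)"
proof -
  have "conv f (star f) 0 = (\<integral>y. of_real ((cmod (f (- y)))\<^sup>2) \<partial>m)"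
    unfolding conv_def star_def complex_norm_square by simp
  also have "\<dots> = of_real (\<integral>y. (cmod (f (- y)))\<^sup>2 \<partial>m)" by (rule integral_complex_of_real)
  also have "(\<integral>y. (cmod (f (- y)))\<^sup>2 \<partial>m) = sq_norm f"
    unfolding sq_norm_def
    by (rule integral_uminus[of "\<lambda>y. (cmod (f y))\<^sup>2"])
      (intro continuous_on_measurable continuous_on_power continuous_on_norm f)
  finally show ?thesis .
qed

lemma sq_norm_pos:
  assumes f: "continuous_on UNIV f" and x: "f x \<noteq> 0"
  shows "sq_norm f > 0"
proof (rule ccontr)
  assume "\<not> sq_norm f > 0"
  then have "sq_norm f = 0" using sq_norm_nonneg[of f] by linarith
  then have int0: "(\<integral>x. (cmod (f x))\<^sup>2 \<partial>m) = 0" unfolding sq_norm_def .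
  have "continuous_on UNIV (\<lambda>x. (cmod (f x))\<^sup>2)" by (intro continuous_on_power continuous_on_norm f)
  from continuous_nonneg_integral_eq_0[OF this _ int0, of x]
  have "(cmod (f x))\<^sup>2 = 0" by simp
  then show False using x by simp
qed

lemma Cauchy_Schwarz_integral:
  fixes f g :: "'g \<Rightarrow> real"
  assumes f: "continuous_on UNIV f" and g: "continuous_on UNIV g"
  shows "(\<integral>x. f x * g x \<partial>m)\<^sup>2 \<le> (\<integral>x. (f x)\<^sup>2 \<partial>m) * (\<integral>x. (g x)\<^sup>2 \<partial>m)"
proof -
  define A B C where "A = (\<integral>x. (f x)\<^sup>2 \<partial>m)" and "B = (\<integral>x. f x * g x \<partial>m)" and "C = (\<integral>x. (g x)\<^sup>2 \<partial>m)"
  have int: "integrable m (\<lambda>x. (f x)\<^sup>2)" "integrable m (\<lambda>x. f x * g x)" "integrable m (\<lambda>x. (g x)\<^sup>2)"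
    by (intro integrable_continuous continuous_on_power continuous_on_mult f g)+
  have quad: "0 \<le> s\<^sup>2 * A - 2 * s * t * B + t\<^sup>2 * C" for s t
  proof -
    have "0 \<le> (\<integral>x. (s * f x - t * g x)\<^sup>2 \<partial>m)" by simp
    also have "\<dots> = (\<integral>x. s\<^sup>2 * (f x)\<^sup>2 - 2 * s * t * (f x * g x) + t\<^sup>2 * (g x)\<^sup>2 \<partial>m)"
      by (simp add: power2_eq_square algebra_simps)
    also have "\<dots> = s\<^sup>2 * A - 2 * s * t * B + t\<^sup>2 * C"
      using int by (simp add: A_def B_def C_def)
    finally show ?thesis .
  qed
  have "C \<ge> 0" by (simp add: C_def)
  show ?thesis
  proof (cases "C = 0")
    case True
    \<comment> \<open>With \<open>C = 0\<close> and \<open>B\<close> nonzero, this choice of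
      \<open>t\<close> makes the quadratic form equal to -1.\<close>
    have "0 \<le> A - 2 * ((A + 1) / (2 * B)) * B" if "B \<noteq> 0"
      using quad[of 1 "(A + 1) / (2 * B)"] True by simp
    then have "B = 0" by (auto split: if_splits)
    then show ?thesis using True by (simp add: B_def C_def)
  next
    case False
    then have C: "C > 0" using \<open>C \<ge> 0\<close> by simp
    \<comment> \<open>The form at \<open>s = C\<close>, \<open>t = B\<close>, up to positive scaling
      the point where it is smallest in \<open>t\<close>.\<close>
    have "0 \<le> C * (C * A - B\<^sup>2)" using quad[of C B] by (simp add: power2_eq_square algebra_simps)
    then have "B\<^sup>2 \<le> A * C" using C by (simp add: zero_le_mult_iff mult.commute)
    then show ?thesis by (simp add: A_def B_def C_def)
  qed
qed

text \<open>Cauchy-Schwarz together with invariance under \<open>y \<mapsto> x - y\<close>. The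
  bound does not depend on \<open>x\<close>, so L2 convergence becomes uniform convergence after one
  convolution.\<close>

lemma conv_bound:
  assumes f: "continuous_on UNIV f" and g: "continuous_on UNIV g"
  shows "(cmod (conv f g x))\<^sup>2 \<le> sq_norm f * sq_norm g"
proof -
  have "cmod (conv f g x) \<le> (\<integral>y. cmod (f (x - y)) * cmod (g y) \<partial>m)"
    unfolding conv_def by (rule order_trans[OF integral_norm_bound]) (simp add: norm_mult)
  then have "(cmod (conv f g x))\<^sup>2 \<le> (\<integral>y. cmod (f (x - y)) * cmod (g y) \<partial>m)\<^sup>2" by (simp add: power_mono)
  also have "\<dots> \<le> (\<integral>y. (cmod (f (x - y)))\<^sup>2 \<partial>m) * (\<integral>y. (cmod (g y))\<^sup>2 \<partial>m)"
    by (intro Cauchy_Schwarz_integral continuous_on_norm continuous_compose_diff f g)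
  also have "(\<integral>y. (cmod (f (x - y)))\<^sup>2 \<partial>m) = sq_norm f"
  proof -
    have c: "continuous_on UNIV (\<lambda>y. (cmod (f y))\<^sup>2)" by (intro continuous_on_power continuous_on_norm f)
    have c': "continuous_on UNIV (\<lambda>y. (cmod (f (x + y)))\<^sup>2)"
      using continuous_on_compose2[OF c continuous_translation[of x]] by simp
    show ?thesis
      using integral_uminus[OF continuous_on_measurable[OF c']]
        integral_translation[OF continuous_on_measurable[OF c], of x]
      by (simp add: sq_norm_def)
  qed
  finally show ?thesis by (simp add: sq_norm_def)
qed

lemma sq_norm_le:
  assumes f: "continuous_on UNIV f" and B: "\<And>x. (cmod (f x))\<^sup>2 \<le> B"
  shows "sq_norm f \<le> B"
proof -
  have "sq_norm f \<le> (\<integral>x. B \<partial>m)"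
    unfolding sq_norm_def
    by (intro integral_mono integrable_continuous continuous_on_power continuous_on_norm f B) simp
  then show ?thesis by simp
qed

lemma tendsto_conv_uniform:
  assumes lim: "uniform_limit UNIV f F sequentially" and f: "\<And>n. continuous_on UNIV (f n)"
    and g: "continuous_on UNIV g"
  shows "(\<lambda>n. conv (f n) g x) \<longlonglongrightarrow> conv F g x"
proof -
  have F: "continuous_on UNIV F"
    by (rule uniform_limit_theorem[OF _ lim]) (simp_all add: f)
  have "(\<lambda>n. (cmod (conv (f n) g x - conv F g x))\<^sup>2) \<longlonglongrightarrow> 0"
  proof (rule LIMSEQ_I)
    fix e :: real assume e: "e > 0"
    define d where "d = sqrt (e / (sq_norm g + 1))"
    have sg: "sq_norm g + 1 > 0" using sq_norm_nonneg[of g] by simp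
    then have d: "d > 0" "d\<^sup>2 * sq_norm g < e" using e sq_norm_nonneg[of g]
      by (auto simp: d_def divide_simps algebra_simps)
    obtain N where N: "\<And>n y. n \<ge> N \<Longrightarrow> dist (f n y) (F y) < d"
      using uniform_limitD[OF lim d(1)] by (auto simp: eventually_sequentially)
    have "(cmod (conv (f n) g x - conv F g x))\<^sup>2 < e" if n: "n \<ge> N" for n
    proof -
      have "(cmod (conv (f n) g x - conv F g x))\<^sup>2 \<le> sq_norm (\<lambda>y. f n y - F y) * sq_norm g"
        using conv_bound[of "\<lambda>y. f n y - F y" g x] conv_diff_left[OF f[of n] F g]
          continuous_on_diff[OF f[of n] F] g by simp
      also have "\<dots> \<le> d\<^sup>2 * sq_norm g"
        using N[OF n] by (intro mult_right_mono sq_norm_nonneg sq_norm_le continuous_on_diff f F)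
          (simp add: dist_norm power_mono less_imp_le)
      finally show ?thesis using d(2) by simp
    qed
    then show "\<exists>N. \<forall>n\<ge>N. norm ((cmod (conv (f n) g x - conv F g x))\<^sup>2 - 0) < e" by auto
  qed
  from tendsto_real_sqrt[OF this]
  have "(\<lambda>n. cmod (conv (f n) g x - conv F g x)) \<longlonglongrightarrow> 0" by simp
  then show ?thesis by (simp add: LIM_zero_cancel tendsto_norm_zero_iff)
qed


section \<open>Characters from convolution idempotents\<close>

text \<open>The convolution algebra has in general no unit, so the powers start at \<open>u\<close>:
  index \<open>k\<close> stands for \<open>k + 1\<close> factors, which explains the
  \<open>Suc\<close> in the product rule.\<close>

primrec conv_power :: "('g \<Rightarrow> complex) \<Rightarrow> nat \<Rightarrow> 'g \<Rightarrow> complex" where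
  "conv_power u 0 = u"
| "conv_power u (Suc k) = conv u (conv_power u k)"

lemma continuous_conv_power: "continuous_on UNIV u \<Longrightarrow> continuous_on UNIV (conv_power u k)"
  by (induction k) (auto intro: continuous_conv)

lemma conv_conv_power:
  assumes u: "continuous_on UNIV u"
  shows "conv (conv_power u j) (conv_power u k) = conv_power u (Suc (j + k))"
  by (induction j) (simp_all add: conv_assoc u continuous_conv_power)

lemma star_conv_power:
  assumes u: "continuous_on UNIV u" "star u = u"
  shows "star (conv_power u k) = conv_power u k"
proof (induction k)
  case (Suc k)
  then show ?case using u by (simp add: star_conv continuous_conv_power)
qed (simp add: u)

text \<open>Seen through Fourier coefficients, these are the sums over finite nonempty sets of
  characters, and \<open>sq_norm\<close> counts the characters.\<close>

definition conv_idempotent :: "('g \<Rightarrow> complex) \<Rightarrow> bool" where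
  "conv_idempotent P \<longleftrightarrow> continuous_on UNIV P \<and> star P = P \<and> conv P P = P \<and> P \<noteq> (\<lambda>_. 0)"

text \<open>In Fourier terms \<open>l\<close> is the largest squared coefficient of
  \<open>u\<close>, and \<open>v k\<close>, the power of \<open>conv u u\<close> with
  \<open>k + 1\<close> factors divided by \<open>l ^ Suc k\<close>, converges to the projection onto
  the coefficients attaining it. Only even powers of \<open>u\<close> converge, since coefficients
  of both signs may attain the maximum. The last conclusion places \<open>P\<close> below every
  \<open>Q\<close> that acts on \<open>u\<close> as a unit.\<close>

lemma top_eigenprojection:
  assumes u: "continuous_on UNIV u" "star u = u" "u \<noteq> (\<lambda>_. 0)"
  obtains P l where "conv_idempotent P" "l > 0" "conv (conv u u) P = (\<lambda>x. of_real l * P x)"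
    "\<And>Q. continuous_on UNIV Q \<Longrightarrow> conv Q u = u \<Longrightarrow> conv Q P = P"
proof -
  let ?p = "conv_power u"
  note cp = continuous_conv_power[OF u(1)]
  define c where "c k = sq_norm (?p k)" for k
  \<comment> \<open>\<open>?p k\<close> is self-adjoint, so its convolution square, which has
    \<open>2 * k + 2\<close> factors, takes its squared norm as value at 0.\<close>
  have c0: "?p (Suc (k + k)) 0 = of_real (c k)" for k
    using conv_star_self_0[OF cp, of k] star_conv_power[OF u(1,2)]
    by (simp add: conv_conv_power[OF u(1)] c_def del: conv_power.simps)
  \<comment> \<open>A product of powers with \<open>k + 1\<close> and \<open>k + 3\<close> factors
    is the square of the power with \<open>k + 2\<close> factors, so \<open>conv_bound\<close> at 0
    is log-convexity.\<close>
  have convex: "(c (Suc k))\<^sup>2 \<le> c k * c (Suc (Suc k))" for k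
  proof -
    have "conv (?p k) (?p (Suc (Suc k))) 0 = of_real (c (Suc k))"
      using c0[of "Suc k"] by (simp add: conv_conv_power[OF u(1)] del: conv_power.simps)
    then show ?thesis using conv_bound[OF cp cp, of k "Suc (Suc k)" 0] by (simp add: c_def del: conv_power.simps)
  qed
  have submult: "c (Suc (j + k)) \<le> c j * c k" for j k
  proof -
    have "(cmod (?p (Suc (j + k)) x))\<^sup>2 \<le> c j * c k" for x
      using conv_bound[OF cp cp, of j k x]
      by (simp add: conv_conv_power[OF u(1)] c_def del: conv_power.simps)
    then show ?thesis unfolding c_def[of "Suc (j + k)"] by (rule sq_norm_le[OF cp])
  qed
  \<comment> \<open>Two consecutive indices are carried because log-convexity yields the next value
    from the two before it. For the base case, the value of \<open>?p 1\<close> at 0 is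
    \<open>c 0\<close>, which is positive.\<close>
  have pos: "c k > 0 \<and> c (Suc k) > 0" for k
  proof (induction k)
    case 0
    obtain x where "u x \<noteq> 0" using u(3) by auto
    then have "c 0 > 0" using sq_norm_pos[OF u(1)] by (simp add: c_def)
    moreover have "?p (Suc 0) 0 \<noteq> 0" using c0[of 0] \<open>c 0 > 0\<close> by simp
    then have "c (Suc 0) > 0" unfolding c_def by (rule sq_norm_pos[OF cp])
    ultimately show ?case ..
  next
    case (Suc k)
    then have "0 < c k * c (Suc (Suc k))" using convex[of k] by (smt (verit) zero_less_power)
    then show ?case using Suc by (simp add: zero_less_mult_iff)
  qed
  then obtain l d where ld: "l > 0" "d \<ge> 1" "(\<lambda>k. c k / l ^ Suc k) \<longlonglongrightarrow> d"
    using log_convex_submultiplicative_limit[of c] convex submult by metis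
  define b where "b k = c k / l ^ Suc k" for k
  define v where "v k = (\<lambda>x. of_real (1 / l ^ Suc k) * ?p (Suc (k + k)) x)" for k
  have cv: "continuous_on UNIV (v k)" for k
    unfolding v_def by (intro continuous_on_mult continuous_on_const cp)
  have star_v: "star (v k) = v k" for k
    using star_conv_power[OF u(1,2), of "Suc (k + k)"]
    by (auto simp: star_def v_def fun_eq_iff simp del: conv_power.simps)
  have v0: "v k 0 = of_real (b k)" for k
    using c0[of k] by (simp add: v_def b_def del: conv_power.simps)
  have vv: "conv (v j) (v k) = v (Suc (j + k))" for j k
  proof -
    have index: "Suc (Suc (j + j) + Suc (k + k)) = Suc (Suc (j + k) + Suc (j + k))" by simp
    show ?thesis
      unfolding v_def conv_scale_left conv_scale_right conv_conv_power[OF u(1)] index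
      by (simp add: fun_eq_iff power_add del: conv_power.simps)
  qed
  \<comment> \<open>The difference is self-adjoint, so its squared norm is its convolution square at
    0, and \<open>vv\<close> expands this into values of \<open>b\<close>. Convergence of the real
    sequence \<open>b\<close> thus makes \<open>v\<close> an L2 Cauchy sequence.\<close>
  have diff: "sq_norm (\<lambda>x. v j x - v k x) = b (Suc (j + j)) + b (Suc (k + k)) - 2 * b (Suc (j + k))" for j k
  proof -
    have "star (\<lambda>x. v j x - v k x) = (\<lambda>x. v j x - v k x)"
      using star_v by (auto simp: star_def fun_eq_iff)
    then have "of_real (sq_norm (\<lambda>x. v j x - v k x)) = conv (\<lambda>x. v j x - v k x) (\<lambda>x. v j x - v k x) 0"
      using conv_star_self_0[OF continuous_on_diff[OF cv cv], of j k] by simp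
    also have "\<dots> = of_real (b (Suc (j + j)) + b (Suc (k + k)) - 2 * b (Suc (j + k)))"
      using continuous_on_diff[OF cv cv]
      by (simp add: conv_diff_left conv_diff_right cv vv v0 add.commute[of k j])
    finally show ?thesis by (simp only: of_real_eq_iff)
  qed
  have b_lim: "b \<longlonglongrightarrow> d" using ld(3) by (simp add: b_def[abs_def])
  \<comment> \<open>Convolution with \<open>v 0\<close> raises the index by one and upgrades the L2
    estimate to a uniform one, hence the sequence starts at \<open>v (Suc k)\<close>.\<close>
  have "uniformly_Cauchy_on UNIV (\<lambda>k. v (Suc k))"
  proof (rule uniformly_Cauchy_onI)
    fix e :: real assume e: "e > 0"
    define s where "s = sq_norm (v 0) + 1"
    have s: "s > 0" using sq_norm_nonneg[of "v 0"] by (simp add: s_def)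
    \<comment> \<open>The three values of \<open>b\<close> in \<open>diff\<close> have weights 1, 1
      and -2; each lies within \<open>t\<close> of \<open>d\<close>, so the combination stays below
      \<open>4 * t\<close>.\<close>
    define t where "t = e\<^sup>2 / s / 4"
    have t: "t > 0" "e\<^sup>2 / s = 4 * t" using e s by (auto simp: t_def)
    obtain N where N: "\<And>n. n \<ge> N \<Longrightarrow> \<bar>b n - d\<bar> < t"
      using LIMSEQ_D[OF b_lim t(1)] by auto
    have "dist (v (Suc j) x) (v (Suc k) x) < e" if jk: "j \<ge> N" "k \<ge> N" for j k x
    proof -
      have "sq_norm (\<lambda>x. v j x - v k x) < e\<^sup>2 / s"
      proof -
        have le: "N \<le> Suc (j + j)" "N \<le> Suc (k + k)" "N \<le> Suc (j + k)" using jk by auto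
        show ?thesis using N[OF le(1)] N[OF le(2)] N[OF le(3)] unfolding diff t(2) by linarith
      qed
      then have *: "s * sq_norm (\<lambda>x. v j x - v k x) < e\<^sup>2" using s by (simp add: field_simps)
      have "conv (v 0) (\<lambda>x. v j x - v k x) x = v (Suc j) x - v (Suc k) x"
        by (simp add: conv_diff_right cv vv)
      then have "(cmod (v (Suc j) x - v (Suc k) x))\<^sup>2 \<le> sq_norm (v 0) * sq_norm (\<lambda>x. v j x - v k x)"
        using conv_bound[OF cv[of 0] continuous_on_diff[OF cv cv], of j k x] by simp
      also have "\<dots> \<le> s * sq_norm (\<lambda>x. v j x - v k x)"
        by (rule mult_right_mono) (simp_all add: s_def sq_norm_nonneg)
      finally have "(cmod (v (Suc j) x - v (Suc k) x))\<^sup>2 < e\<^sup>2" using * by linarith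
      then show ?thesis using e by (simp add: dist_norm power2_less_imp_less)
    qed
    then show "\<exists>N. \<forall>x\<in>UNIV. \<forall>j\<ge>N. \<forall>k\<ge>N. dist (v (Suc j) x) (v (Suc k) x) < e" by blast
  qed
  then obtain P where P: "uniform_limit UNIV (\<lambda>k. v (Suc k)) P sequentially"
    using Cauchy_uniformly_convergent unfolding uniformly_convergent_on_def by blast
  have cP: "continuous_on UNIV P"
    by (rule uniform_limit_theorem[OF _ P]) (simp_all add: cv)
  have limP: "(\<lambda>k. v (k + n) x) \<longlonglongrightarrow> P x" for n x
  proof -
    have "(\<lambda>k. v (Suc k) x) \<longlonglongrightarrow> P x" by (rule tendsto_uniform_limitI[OF P]) simp
    then have "(\<lambda>k. v k x) \<longlonglongrightarrow> P x" by (rule LIMSEQ_imp_Suc)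
    then show ?thesis by (rule LIMSEQ_ignore_initial_segment)
  qed
  have star_P: "star P = P"
  proof
    fix x
    have "(\<lambda>k. star (v (k + 0)) x) \<longlonglongrightarrow> star P x"
      unfolding star_def by (rule tendsto_cnj[OF limP])
    then show "star P x = P x"
      using limP[of 0 x] by (simp add: star_v LIMSEQ_unique)
  qed
  have Pv: "conv P (v k) = P" for k
  proof
    fix x
    have "(\<lambda>j. conv (v (Suc j)) (v k) x) \<longlonglongrightarrow> conv P (v k) x"
      by (rule tendsto_conv_uniform[OF P]) (rule cv)+
    moreover have "(\<lambda>j. conv (v (Suc j)) (v k) x) \<longlonglongrightarrow> P x"
      using limP[of "Suc (Suc k)" x] by (simp add: vv)
    ultimately show "conv P (v k) x = P x" by (rule LIMSEQ_unique)
  qed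
  have PP: "conv P P = P"
  proof
    fix x
    have "(\<lambda>k. conv (v (Suc k)) P x) \<longlonglongrightarrow> conv P P x"
      by (rule tendsto_conv_uniform[OF P]) (rule cv cP)+
    moreover have "conv (v (Suc k)) P = P" for k using Pv conv_commute[OF cv cP] by simp
    ultimately show "conv P P x = P x" by (simp add: LIMSEQ_const_iff)
  qed
  \<comment> \<open>Here \<open>d \<ge> 1\<close> enters: the normalised powers do not die out in
    the limit.\<close>
  have "P 0 = of_real d"
  proof -
    have "(\<lambda>k. v k 0) \<longlonglongrightarrow> of_real d" unfolding v0 by (rule tendsto_of_real[OF b_lim])
    then show ?thesis using limP[of 0 0] LIMSEQ_unique by fastforce
  qed
  then have "P 0 \<noteq> 0" using ld(2) by auto
  then have idem: "conv_idempotent P" unfolding conv_idempotent_def using cP star_P PP by auto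
  have eigen: "conv (conv u u) P = (\<lambda>x. of_real l * P x)"
  proof -
    have "(\<lambda>x. of_real l * v 0 x) = conv u u" using ld(1) by (auto simp: v_def)
    then have "conv (conv u u) P = (\<lambda>x. of_real l * conv (v 0) P x)" by (metis conv_scale_left)
    also have "conv (v 0) P = P" using Pv conv_commute[OF cv cP] by simp
    finally show ?thesis .
  qed
  have absorb: "conv Q P = P" if Q: "continuous_on UNIV Q" "conv Q u = u" for Q
  proof
    fix x
    have Qp: "conv Q (?p k) = ?p k" for k
      by (induction k) (simp_all add: Q conv_assoc[OF Q(1) u(1) cp, symmetric])
    have Qv: "conv Q (v k) = v k" for k
      unfolding v_def conv_scale_right Qp ..
    have "(\<lambda>k. conv (v (Suc k)) Q x) \<longlonglongrightarrow> conv P Q x"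
      by (rule tendsto_conv_uniform[OF P]) (rule cv Q)+
    then have "(\<lambda>k. v (Suc k) x) \<longlonglongrightarrow> conv Q P x"
      by (simp add: conv_commute[OF _ Q(1)] cv cP Qv)
    then show "conv Q P x = P x" using limP[of 1 x] LIMSEQ_unique by fastforce
  qed
  show ?thesis
  proof (rule that[OF idem ld(1) eigen])
    show "conv Q P = P" if "continuous_on UNIV Q" "conv Q u = u" for Q
      by (rule absorb[OF that])
  qed
qed

text \<open>Since \<open>P\<close> equals \<open>conv P (star P)\<close>, its value at 0 is its
  squared norm, and \<open>conv_bound\<close> applied to \<open>conv P P\<close> bounds all other
  values by it. Integrating the square of that bound gives
  \<open>sq_norm P \<le> (sq_norm P)\<^sup>2\<close>, hence the lower bound 1.\<close>

lemma conv_idempotent_0: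
  assumes "conv_idempotent P"
  shows "P 0 = of_real (sq_norm P)" "cmod (P x) \<le> sq_norm P" "sq_norm P \<ge> 1"
proof -
  have P: "continuous_on UNIV P" "star P = P" "conv P P = P" "P \<noteq> (\<lambda>_. 0)"
    using assms by (auto simp: conv_idempotent_def)
  show "P 0 = of_real (sq_norm P)" using conv_star_self_0[OF P(1)] P by simp
  have *: "(cmod (P x))\<^sup>2 \<le> (sq_norm P)\<^sup>2" for x
    using conv_bound[OF P(1) P(1), of x] P(3) by (simp add: power2_eq_square)
  then show "cmod (P x) \<le> sq_norm P" by (rule power2_le_imp_le) (rule sq_norm_nonneg)
  have "sq_norm P \<le> sq_norm P * sq_norm P" using sq_norm_le[OF P(1) *] by (simp add: power2_eq_square)
  moreover obtain x where "P x \<noteq> 0" using P(4) by auto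
  then have "sq_norm P > 0" by (rule sq_norm_pos[OF P(1)])
  ultimately show "sq_norm P \<ge> 1" by simp
qed

text \<open>Squared norms of idempotents are values at 0, so they subtract exactly.\<close>

lemma conv_idempotent_minus:
  assumes Q: "conv_idempotent Q" and R: "conv_idempotent R" and QR: "conv Q R = R" "R \<noteq> Q"
  shows "conv_idempotent (\<lambda>x. Q x - R x)" "sq_norm (\<lambda>x. Q x - R x) = sq_norm Q - sq_norm R"
proof -
  have c: "continuous_on UNIV Q" "continuous_on UNIV R" and s: "star Q = Q" "star R = R"
    and i: "conv Q Q = Q" "conv R R = R"
    using Q R by (auto simp: conv_idempotent_def)
  have RQ: "conv R Q = R" using QR(1) conv_commute[OF c] by simp
  have cd: "continuous_on UNIV (\<lambda>x. Q x - R x)" by (rule continuous_on_diff[OF c])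
  have "conv (\<lambda>x. Q x - R x) (\<lambda>x. Q x - R x) = (\<lambda>x. Q x - R x)"
    using cd by (simp add: conv_diff_left conv_diff_right c i RQ QR)
  moreover have "star (\<lambda>x. Q x - R x) = (\<lambda>x. Q x - R x)" using s by (auto simp: star_def fun_eq_iff)
  moreover have "(\<lambda>x. Q x - R x) \<noteq> (\<lambda>_. 0)"
    using QR(2) ext[of R Q] by (metis eq_iff_diff_eq_0)
  ultimately show *: "conv_idempotent (\<lambda>x. Q x - R x)" using cd by (simp add: conv_idempotent_def)
  have "complex_of_real (sq_norm (\<lambda>x. Q x - R x)) = of_real (sq_norm Q - sq_norm R)"
    unfolding of_real_diff conv_idempotent_0(1)[OF *, symmetric] conv_idempotent_0(1)[OF Q, symmetric]
      conv_idempotent_0(1)[OF R, symmetric] ..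
  then show "sq_norm (\<lambda>x. Q x - R x) = sq_norm Q - sq_norm R" by (simp only: of_real_eq_iff)
qed

text \<open>The condition \<open>conv Q R = R\<close> is the usual order of projections, with
  \<open>R\<close> below \<open>Q\<close>.\<close>

definition minimal_idempotent :: "('g \<Rightarrow> complex) \<Rightarrow> bool" where
  "minimal_idempotent Q \<longleftrightarrow> conv_idempotent Q \<and> (\<forall>R. conv_idempotent R \<and> conv Q R = R \<longrightarrow> R = Q)"

text \<open>An idempotent whose squared norm is within 1 of the infimum below \<open>P\<close> is
  minimal: a proper idempotent under it would leave a nonzero idempotent difference of squared norm
  less than 1.\<close>

lemma minimal_idempotent_below:
  assumes P: "conv_idempotent P"
  obtains Q where "minimal_idempotent Q" "conv P Q = Q"
proof -
  define I where "I = {Q. conv_idempotent Q \<and> conv P Q = Q}"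
  define t where "t = (INF Q\<in>I. sq_norm Q)"
  have "P \<in> I" using P by (auto simp: I_def conv_idempotent_def)
  have bdd: "bdd_below (sq_norm ` I)"
    by (rule bdd_belowI[of _ 0]) (auto intro: sq_norm_nonneg)
  obtain Q where Q: "Q \<in> I" "sq_norm Q < t + 1"
    using cINF_less_iff[OF _ bdd, of "t + 1"] \<open>P \<in> I\<close> by (auto simp: t_def)
  have "R = Q" if R: "conv_idempotent R" "conv Q R = R" for R
  proof (rule ccontr)
    assume "R \<noteq> Q"
    have Q': "conv_idempotent Q" "conv P Q = Q" using Q by (auto simp: I_def)
    note D = conv_idempotent_minus[OF Q'(1) R \<open>R \<noteq> Q\<close>]
    have c: "continuous_on UNIV P" "continuous_on UNIV Q" "continuous_on UNIV R"
      using P Q' R by (auto simp: conv_idempotent_def)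
    have "conv P R = R" using conv_assoc[OF c] R(2) Q'(2) by simp
    then have "R \<in> I" using R by (simp add: I_def)
    then have "t \<le> sq_norm R" unfolding t_def by (rule cINF_lower[OF bdd])
    then have "sq_norm (\<lambda>x. Q x - R x) < 1" using D(2) Q(2) by simp
    then show False using conv_idempotent_0(3)[OF D(1)] by simp
  qed
  then show ?thesis using that[of Q] Q by (auto simp: I_def minimal_idempotent_def)
qed

text \<open>If \<open>v * v = \<lambda> Q\<close> and \<open>v \<noteq> \<surd>\<lambda> Q\<close>, then \<open>w = v - \<surd>\<lambda> Q\<close> is invertible in the unital algebra with
  unit \<open>Q\<close>, so that \<open>w * (v + \<surd>\<lambda> Q) = 0\<close> forces \<open>v = - \<surd>\<lambda> Q\<close>.\<close>

lemma minimal_idempotent_selfadjoint: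
  assumes Q: "minimal_idempotent Q" and v: "continuous_on UNIV v" "star v = v" "conv Q v = v"
  obtains a :: real where "v = (\<lambda>x. of_real a * Q x)"
proof -
  have idem: "conv_idempotent Q" and min: "\<And>R. conv_idempotent R \<Longrightarrow> conv Q R = R \<Longrightarrow> R = Q"
    using Q by (auto simp: minimal_idempotent_def)
  have cQ: "continuous_on UNIV Q" and sQ: "star Q = Q" and QQ: "conv Q Q = Q"
    using idem by (auto simp: conv_idempotent_def)
  \<comment> \<open>The top projection of \<open>w\<close> lies below \<open>Q\<close>, because
    \<open>Q\<close> acts on \<open>w\<close> as a unit. Minimality makes it equal to
    \<open>Q\<close>, and its eigenvalue equation then describes all of
    \<open>conv w w\<close>.\<close>
  have square: "\<exists>l>0. conv w w = (\<lambda>x. of_real l * Q x)"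
    if w: "continuous_on UNIV w" "star w = w" "conv Q w = w" "w \<noteq> (\<lambda>_. 0)" for w
  proof -
    obtain P l where P: "conv_idempotent P" "l > 0" "conv (conv w w) P = (\<lambda>x. of_real l * P x)"
        "\<And>Q. continuous_on UNIV Q \<Longrightarrow> conv Q w = w \<Longrightarrow> conv Q P = P"
      using top_eigenprojection[OF w(1,2,4)] by metis
    have PQ: "P = Q" using min[OF P(1) P(4)[OF cQ w(3)]] .
    have "conv (conv w w) Q = conv Q (conv w w)" using conv_commute continuous_conv[OF w(1) w(1)] cQ by blast
    also have "\<dots> = conv w w" using conv_assoc[OF cQ w(1) w(1)] w(3) by simp
    finally show ?thesis using P(2,3) PQ by auto
  qed
  show ?thesis
  proof (cases "v = (\<lambda>_. 0)")
    case True
    then show ?thesis using that[of 0] by simp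
  next
    case False
    then obtain l where l: "l > 0" "conv v v = (\<lambda>x. of_real l * Q x)" using square v by blast
    define s where "s = sqrt l"
    have s: "of_real s * of_real s = (of_real l :: complex)" using l(1) by (simp add: s_def flip: of_real_mult)
    define w z where "w = (\<lambda>x. v x - of_real s * Q x)" and "z = (\<lambda>x. v x + of_real s * Q x)"
    have csQ: "continuous_on UNIV (\<lambda>x. of_real s * Q x)"
      by (intro continuous_on_mult continuous_on_const cQ)
    have cw: "continuous_on UNIV w" and cz: "continuous_on UNIV z"
      unfolding w_def z_def using v(1) csQ by (auto intro: continuous_on_diff continuous_on_add)
    have vQ: "conv v Q = v" using v(3) conv_commute[OF v(1) cQ] by simp
    have Qw: "conv Q w = w" and Qz: "conv Q z = z"
      unfolding w_def z_def by (simp_all add: conv_diff_right conv_add_right v csQ cQ conv_scale_right QQ)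
    have sw: "star w = w" using v(2) sQ by (auto simp: star_def w_def fun_eq_iff)
    have wz: "conv w z = (\<lambda>_. 0)"
      unfolding w_def z_def using cz[unfolded z_def]
      by (simp add: conv_diff_left conv_add_right v(1) csQ cQ conv_scale_left conv_scale_right QQ vQ v(3)
          l(2) s[symmetric]) (simp add: fun_eq_iff algebra_simps)
    show ?thesis
    proof (cases "w = (\<lambda>_. 0)")
      case True
      then have "v = (\<lambda>x. of_real s * Q x)" by (auto simp: w_def fun_eq_iff)
      then show ?thesis by (rule that)
    next
      case False
      then obtain k where k: "k > 0" "conv w w = (\<lambda>x. of_real k * Q x)" using square cw sw Qw by blast
      have "(\<lambda>x. of_real k * z x) = conv (conv w w) z" unfolding k(2) conv_scale_left Qz ..
      also have "\<dots> = conv w (conv w z)" by (rule conv_assoc[OF cw cw cz])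
      also have "\<dots> = (\<lambda>_. 0)" by (auto simp: wz conv_def)
      finally have "v = (\<lambda>x. of_real (- s) * Q x)"
        using k(1) by (auto simp: z_def fun_eq_iff add_eq_0_iff2)
      then show ?thesis by (rule that)
    qed
  qed
qed

lemma minimal_idempotent_character:
  assumes "minimal_idempotent Q"
  obtains \<gamma> where "\<gamma> \<in> dual_group" "Q = (\<lambda>x. Q 0 * \<gamma> x)" "Q 0 \<noteq> 0"
proof -
  have idem: "conv_idempotent Q" using assms by (simp add: minimal_idempotent_def)
  then have cQ: "continuous_on UNIV Q" and sQ: "star Q = Q" and QQ: "conv Q Q = Q"
    by (auto simp: conv_idempotent_def)
  have Qm: "cnj (Q (- x)) = Q x" for x using sQ by (metis star_def)
  define T where "T y = (\<lambda>x. Q (x + y))" for y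
  have cT: "continuous_on UNIV (T y)" for y
    unfolding T_def by (rule continuous_on_compose2[OF cQ continuous_on_add[OF continuous_on_id continuous_on_const]]) simp
  have QT: "conv Q (T y) = T y" for y
  proof -
    have "conv (T y) Q = T y"
    proof
      fix x
      have "conv (T y) Q x = conv Q Q (x + y)" by (simp add: conv_def T_def add.commute add_diff_eq)
      then show "conv (T y) Q x = T y x" by (simp add: QQ T_def)
    qed
    then show ?thesis using conv_commute[OF cT cQ] by simp
  qed
  \<comment> \<open>The involution sends \<open>T y\<close> to \<open>T (- y)\<close>, so their sum
    and \<i> times their difference are self-adjoint. Both are then real multiples of
    \<open>Q\<close>, and \<open>T y\<close> is a complex one.\<close>
  have "\<exists>c. \<forall>x. Q (x + y) = c * Q x" for y
  proof -
    have sT: "cnj (T y (- x)) = T (- y) x" for x y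
      using Qm[of "x - y"] by (simp add: T_def)
    have plus: "conv Q (\<lambda>x. T y x + T (- y) x) = (\<lambda>x. T y x + T (- y) x)"
      "star (\<lambda>x. T y x + T (- y) x) = (\<lambda>x. T y x + T (- y) x)"
      by (simp_all add: conv_add_right cT cQ QT star_def fun_eq_iff sT)
    obtain a where a: "(\<lambda>x. T y x + T (- y) x) = (\<lambda>x. of_real a * Q x)"
      by (rule minimal_idempotent_selfadjoint[OF assms continuous_on_add[OF cT cT] plus(2,1)])
    have minus: "conv Q (\<lambda>x. \<i> * (T y x - T (- y) x)) = (\<lambda>x. \<i> * (T y x - T (- y) x))"
      unfolding conv_scale_right by (simp add: conv_diff_right cT cQ QT)
    have minus': "star (\<lambda>x. \<i> * (T y x - T (- y) x)) = (\<lambda>x. \<i> * (T y x - T (- y) x))"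
      by (simp add: star_def fun_eq_iff sT algebra_simps)
    have c_minus: "continuous_on UNIV (\<lambda>x. \<i> * (T y x - T (- y) x))"
      by (intro continuous_on_mult continuous_on_const continuous_on_diff cT)
    obtain b where b: "(\<lambda>x. \<i> * (T y x - T (- y) x)) = (\<lambda>x. of_real b * Q x)"
      by (rule minimal_idempotent_selfadjoint[OF assms c_minus minus' minus])
    have "Q (x + y) = ((of_real a - \<i> * of_real b) / 2) * Q x" for x
    proof -
      have "2 * T y x = (T y x + T (- y) x) - \<i> * (\<i> * (T y x - T (- y) x))" by (simp add: algebra_simps)
      also have "\<dots> = of_real a * Q x - \<i> * (of_real b * Q x)"
        using fun_cong[OF a, of x] fun_cong[OF b, of x] by simp
      finally show ?thesis by (simp add: T_def algebra_simps)
    qed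
    then show ?thesis by blast
  qed
  then obtain c where c: "\<And>x y. Q (x + y) = c y * Q x" by metis
  have Q0: "Q 0 \<noteq> 0" using conv_idempotent_0(1,3)[OF idem] by auto
  have Qc: "Q y = c y * Q 0" for y using c[of 0 y] by simp
  have mult: "c (x + y) = c x * c y" for x y
    using c[of x y] Qc[of "x + y"] Qc[of x] Q0 by simp
  have "c 0 = 1" using Qc[of 0] Q0 by simp
  \<comment> \<open>An idempotent is largest at 0. Together with \<open>c x * c (- x) = 1\<close>
    this forces modulus exactly 1.\<close>
  have le: "cmod (c x) \<le> 1" for x
  proof -
    have "cmod (c x) * cmod (Q 0) \<le> cmod (Q 0)"
      using conv_idempotent_0(2)[OF idem, of x] conv_idempotent_0(1)[OF idem] sq_norm_nonneg[of Q]
      by (metis Qc norm_mult norm_of_real abs_of_nonneg)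
    then show ?thesis using Q0 by simp
  qed
  have "cmod (c x) = 1" for x
  proof -
    have "cmod (c x) * cmod (c (- x)) = 1" using mult[of x "- x"] \<open>c 0 = 1\<close> by (simp flip: norm_mult)
    moreover have "cmod (c x) * cmod (c (- x)) \<le> cmod (c x)" using le[of "- x"] by (simp add: mult_left_le)
    ultimately show ?thesis using le[of x] by simp
  qed
  moreover have "continuous_on UNIV c"
  proof -
    have "c x = Q x / Q 0" for x using Qc[of x] Q0 by simp
    then have "c = (\<lambda>x. Q x / Q 0)" by (rule ext)
    then show ?thesis using cQ Q0 by (auto intro!: continuous_on_divide continuous_on_const)
  qed
  ultimately have dual: "c \<in> dual_group" using mult by (simp add: dual_group_def)
  have "Q x = Q 0 * c x" for x using Qc[of x] by (simp only: mult.commute)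
  then have "Q = (\<lambda>x. Q 0 * c x)" by (rule ext)
  from that[OF dual this Q0] show ?thesis .
qed

section \<open>Completeness of the characters\<close>

lemma dual_group_uminus:
  fixes \<gamma> :: "'g \<Rightarrow> complex"
  assumes "\<gamma> \<in> dual_group"
  shows "\<gamma> (- x) = cnj (\<gamma> x)" "\<gamma> 0 = 1"
proof -
  have \<gamma>: "cmod (\<gamma> x) = 1" "\<gamma> (x + y) = \<gamma> x * \<gamma> y" for x y using assms by (auto simp: dual_group_def)
  show "\<gamma> 0 = 1" using \<gamma>(2)[of 0 0] \<gamma>(1)[of 0] by auto
  then have "\<gamma> x * \<gamma> (- x) = \<gamma> x * cnj (\<gamma> x)"
    using \<gamma>(2)[of x "- x"] \<gamma>(1)[of x] by (simp add: complex_norm_square[symmetric])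
  moreover have "\<gamma> x \<noteq> 0" using \<gamma>(1)[of x] by auto
  ultimately show "\<gamma> (- x) = cnj (\<gamma> x)" by simp
qed

text \<open>Passing to \<open>conv g (star g)\<close> makes the element self-adjoint, and its value
  at 0, the squared norm of \<open>g\<close>, shows that it is nonzero. A minimal idempotent
  \<open>Q\<close> under its top projection supplies the character. If the coefficient of
  \<open>g\<close> there vanished, then \<open>conv g Q\<close> would vanish, contradicting the
  eigenvalue \<open>l > 0\<close> of \<open>conv u u\<close> on \<open>Q\<close>.\<close>

theorem Fourier_uniqueness:
  assumes g: "continuous_on UNIV g" "g \<noteq> (\<lambda>_. 0)"
  obtains \<gamma> where "\<gamma> \<in> dual_group" "(\<integral>x. g x * cnj (\<gamma> x) \<partial>m) \<noteq> 0"
proof -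
  define u where "u = conv g (star g)"
  have cu: "continuous_on UNIV u" unfolding u_def by (intro continuous_conv continuous_star g)
  have su: "star u = u"
    unfolding u_def by (simp add: star_conv g continuous_star conv_commute)
  obtain x where "g x \<noteq> 0" using g(2) by auto
  then have "u 0 \<noteq> 0" using conv_star_self_0[OF g(1)] sq_norm_pos[OF g(1), of x] by (simp add: u_def)
  then have "u \<noteq> (\<lambda>_. 0)" by auto
  then obtain P l where P: "conv_idempotent P" "l > 0" "conv (conv u u) P = (\<lambda>x. of_real l * P x)"
    using top_eigenprojection[OF cu su] by metis
  obtain Q where Q: "minimal_idempotent Q" "conv P Q = Q" using minimal_idempotent_below[OF P(1)] by metis
  obtain \<gamma> where \<gamma>: "\<gamma> \<in> dual_group" "Q = (\<lambda>x. Q 0 * \<gamma> x)" "Q 0 \<noteq> 0"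
    using minimal_idempotent_character[OF Q(1)] by metis
  have c: "continuous_on UNIV P" "continuous_on UNIV Q"
    using P(1) Q(1) by (auto simp: conv_idempotent_def minimal_idempotent_def)
  have "(\<integral>x. g x * cnj (\<gamma> x) \<partial>m) \<noteq> 0"
  proof
    assume zero: "(\<integral>x. g x * cnj (\<gamma> x) \<partial>m) = 0"
    have mult: "\<gamma> (x - y) = \<gamma> x * cnj (\<gamma> y)" for x y
    proof -
      have "\<gamma> (x + - y) = \<gamma> x * \<gamma> (- y)" using \<gamma>(1) unfolding dual_group_def by blast
      then show ?thesis by (simp add: dual_group_uminus[OF \<gamma>(1)])
    qed
    have "conv Q g x = 0" for x
    proof -
      have "conv Q g x = (\<integral>y. Q 0 * \<gamma> x * (g y * cnj (\<gamma> y)) \<partial>m)"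
        unfolding conv_def by (subst \<gamma>(2)) (simp add: mult mult_ac)
      then show ?thesis using zero by simp
    qed
    then have Qg: "conv g Q = (\<lambda>_. 0)" using conv_commute[OF g(1) c(2)] by auto
    have cs: "continuous_on UNIV (star g)" by (rule continuous_star[OF g(1)])
    have "conv u Q = conv (conv (star g) g) Q" unfolding u_def using conv_commute[OF g(1) cs] by simp
    also have "\<dots> = conv (star g) (conv g Q)" by (rule conv_assoc[OF cs g(1) c(2)])
    also have "\<dots> = (\<lambda>_. 0)" by (auto simp: Qg conv_def)
    finally have "conv (conv u u) Q = (\<lambda>_. 0)" by (auto simp: conv_assoc[OF cu cu c(2)]) (auto simp: conv_def)
    moreover have "conv (conv u u) Q = (\<lambda>x. of_real l * Q x)"
      using conv_assoc[OF continuous_conv[OF cu cu] c] P(3) Q(2) by (simp add: conv_scale_left)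
    ultimately show False using P(2) \<gamma>(3) by (auto simp: fun_eq_iff)
  qed
  then show ?thesis using that \<gamma>(1) by blast
qed


section \<open>Sets invariant under translations\<close>

text \<open>The annihilator of \<open>H\<close> is trivial, which by duality means that
  \<open>H\<close> generates a dense subgroup.\<close>

definition separating_subset :: "'g set \<Rightarrow> bool" where
  "separating_subset H \<longleftrightarrow> (\<forall>\<gamma>\<in>dual_group. (\<forall>h\<in>H. \<gamma> h = 1) \<longrightarrow> \<gamma> = trivial_character)"

lemma continuous_translation_prod:
  assumes f: "continuous_on UNIV (f :: 'g \<Rightarrow> 'b::topological_space)"
  shows "continuous_on UNIV (\<lambda>p. f (fst p + snd p))"
  by (rule continuous_on_compose2[OF f continuous_on_add[OF continuous_on_fst continuous_on_snd]])
    (auto intro: continuous_on_id)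

text \<open>The smoothed function \<open>\<phi>\<close> is continuous, \<open>H\<close>-invariant
  and has Haar mean \<open>I\<close>. Translation by \<open>h\<close> multiplies the coefficient of
  \<open>\<phi> - I\<close> at \<open>\<gamma>\<close> by \<open>cnj (\<gamma> h)\<close>, so only
  the trivial character could contribute, and there the coefficient is 0 by the choice of
  \<open>I\<close>. Thus \<open>\<phi>\<close> is constantly \<open>I\<close>, and its value at 0 is
  the integral of \<open>f\<close> against \<open>\<nu>\<close>.\<close>

lemma invariant_measure_unique:
  assumes \<nu>: "prob_space \<nu>" "sets \<nu> = sets borel" "compact_regular \<nu>"
    and inv: "\<And>h. h \<in> H \<Longrightarrow> distr \<nu> \<nu> (\<lambda>x. h + x) = \<nu>"
    and sep: "separating_subset H"
  shows "\<nu> = m"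
proof -
  interpret nu: prob_space \<nu> by (rule \<nu>(1))
  show ?thesis
  proof (rule regular_measure_eqI[OF compact_UNIV finite_measure_axioms sets_m
        nu.finite_measure_axioms \<nu>(2) regular \<nu>(3)])
    fix f :: "'g \<Rightarrow> real" assume f: "continuous_on UNIV f"
    define \<phi> where "\<phi> x = (\<integral>y. f (x + y) \<partial>\<nu>)" for x
    define I where "I = (\<integral>x. f x \<partial>m)"
    interpret P: pair_sigma_finite m \<nu> ..
    have F: "continuous_on UNIV (\<lambda>(x, y). f (x + y))"
      using continuous_translation_prod[OF f] by (simp add: split_beta)
    have c\<phi>: "continuous_on UNIV \<phi>"
      using continuous_on_integral_parameter[OF compact_UNIV F nu.finite_measure_axioms \<nu>(2)]
      by (simp add: \<phi>_def[abs_def])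
    have int: "integrable (m \<Otimes>\<^sub>M \<nu>) (\<lambda>(x, y). f (x + y))"
      by (rule continuous_on_prod_integrable[OF compact_UNIV compact_UNIV F finite_measure_axioms sets_m
        nu.finite_measure_axioms \<nu>(2)])
    have "(\<integral>x. \<phi> x \<partial>m) = (\<integral>y. (\<integral>x. f (x + y) \<partial>m) \<partial>\<nu>)"
      unfolding \<phi>_def using P.Fubini_integral[OF int] by simp
    also have "\<dots> = (\<integral>y. I \<partial>\<nu>)"
      unfolding I_def
      using integral_translation[OF continuous_on_measurable[OF f]] by (simp add: add.commute)
    also have "\<dots> = I" using nu.prob_space by simp
    finally have mean: "(\<integral>x. \<phi> x \<partial>m) = I" .
    have fm: "(\<lambda>y. f (x + y)) \<in> borel_measurable \<nu>" for x
      using borel_measurable_continuous_onI[OF continuous_on_compose2[OF f continuous_translation]]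
      by (simp add: measurable_cong_sets[OF \<nu>(2) refl])
    have tm: "(\<lambda>x. h + x) \<in> measurable \<nu> \<nu>" for h
      using borel_measurable_continuous_onI[OF continuous_translation]
      by (simp add: measurable_cong_sets[OF \<nu>(2) \<nu>(2)])
    have \<phi>_inv: "\<phi> (h + x) = \<phi> x" if "h \<in> H" for h x
    proof -
      have "\<phi> x = (\<integral>y. f (x + y) \<partial>distr \<nu> \<nu> (\<lambda>y. h + y))" unfolding \<phi>_def inv[OF that] ..
      also have "\<dots> = (\<integral>y. f (x + (h + y)) \<partial>\<nu>)" by (rule integral_distr[OF tm fm])
      also have "\<dots> = \<phi> (h + x)" by (simp add: \<phi>_def ac_simps)
      finally show ?thesis ..
    qed
    define g where "g x = complex_of_real (\<phi> x - I)" for x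
    have cg: "continuous_on UNIV g"
      unfolding g_def by (intro continuous_on_of_real continuous_on_diff c\<phi> continuous_on_const)
    have "g = (\<lambda>_. 0)"
    proof (rule ccontr)
      assume "g \<noteq> (\<lambda>_. 0)"
      then obtain \<gamma> where \<gamma>: "\<gamma> \<in> dual_group" "(\<integral>x. g x * cnj (\<gamma> x) \<partial>m) \<noteq> 0"
        using Fourier_uniqueness[OF cg] by blast
      have \<gamma>_mult: "\<gamma> (x + y) = \<gamma> x * \<gamma> y" for x y using \<gamma>(1) unfolding dual_group_def by blast
      have c\<gamma>: "continuous_on UNIV \<gamma>" using \<gamma>(1) unfolding dual_group_def by blast
      have "\<gamma> h = 1" if h: "h \<in> H" for h
      proof -
        have "continuous_on UNIV (\<lambda>x. g x * cnj (\<gamma> x))"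
          by (intro continuous_on_mult continuous_on_cnj cg c\<gamma>)
        from integral_translation[OF continuous_on_measurable[OF this], of h]
        have "(\<integral>x. g x * cnj (\<gamma> x) \<partial>m) = (\<integral>x. cnj (\<gamma> h) * (g x * cnj (\<gamma> x)) \<partial>m)"
          by (simp add: g_def \<phi>_inv[OF h] \<gamma>_mult mult_ac)
        also have "\<dots> = cnj (\<gamma> h) * (\<integral>x. g x * cnj (\<gamma> x) \<partial>m)" by simp
        finally have "cnj (\<gamma> h) = 1" using \<gamma>(2) by simp
        then show ?thesis using complex_cnj_one complex_cnj_cancel_iff by metis
      qed
      then have "\<gamma> = trivial_character" using sep \<gamma>(1) by (auto simp: separating_subset_def)
      then have "(\<integral>x. g x * cnj (\<gamma> x) \<partial>m) = complex_of_real (\<integral>x. \<phi> x - I \<partial>m)"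
        unfolding g_def by (simp only: trivial_character_def complex_cnj_one mult_1_right integral_complex_of_real)
      also have "(\<integral>x. \<phi> x - I \<partial>m) = 0" using mean integrable_continuous[OF c\<phi>] by simp
      finally show False using \<gamma>(2) by simp
    qed
    then have "g 0 = 0" by simp
    then show "(\<integral>x. f x \<partial>\<nu>) = (\<integral>x. f x \<partial>m)" by (simp add: g_def \<phi>_def I_def)
  qed
qed

section \<open>Zero-one laws for sets invariant under separating translations\<close>

lemma compact_regular_uniform_measure:
  assumes B: "B \<in> sets borel" "emeasure m B \<noteq> 0"
  shows "compact_regular (uniform_measure m B)"
proof (rule compact_regularI)
  fix A :: "'g set" assume A: "A \<in> sets borel"
  have BA: "B \<inter> A \<in> sets m" using A B by simp
  have "emeasure (uniform_measure m B) A
      = (SUP K\<in>{K. K \<subseteq> B \<inter> A \<and> compact K}. emeasure m K) / emeasure m B"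
    using regular A B BA unfolding compact_regular_def by simp
  also have "\<dots> = (SUP K\<in>{K. K \<subseteq> B \<inter> A \<and> compact K}. emeasure m K / emeasure m B)"
    by (rule SUP_divide_ennreal)
  also have "\<dots> \<le> (SUP K\<in>{K. K \<subseteq> A \<and> compact K}. emeasure (uniform_measure m B) K)"
  proof (rule SUP_mono)
    fix K assume K: "K \<in> {K. K \<subseteq> B \<inter> A \<and> compact K}"
    then have "closed K" "B \<inter> K = K" by (auto intro: compact_imp_closed)
    then have "K \<in> sets m" by simp
    with \<open>B \<inter> K = K\<close> have "emeasure m K / emeasure m B = emeasure (uniform_measure m B) K" using B by simp
    then show "\<exists>L\<in>{K. K \<subseteq> A \<and> compact K}. emeasure m K / emeasure m B \<le> emeasure (uniform_measure m B) L"
      using K by (intro bexI[of _ K]) auto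
  qed
  finally show "emeasure (uniform_measure m B) A
      \<le> (SUP K\<in>{K. K \<subseteq> A \<and> compact K}. emeasure (uniform_measure m B) K)" .
qed simp

text \<open>Haar measure conditioned on a non-null invariant \<open>B\<close> is a regular
  \<open>H\<close>-invariant probability, hence Haar measure itself; but it gives \<open>B\<close>
  mass 1.\<close>

lemma invariant_set_trivial:
  assumes B: "B \<in> sets borel" and sep: "separating_subset H"
    and inv: "\<And>h x. h \<in> H \<Longrightarrow> h + x \<in> B \<longleftrightarrow> x \<in> B"
  shows "emeasure m B = 0 \<or> emeasure m B = 1"
proof (cases "emeasure m B = 0")
  case False
  let ?\<nu> = "uniform_measure m B"
  have prob: "prob_space ?\<nu>" by (rule prob_space_uniform_measure[OF False]) simp
  have tm: "(\<lambda>x. h + x) \<in> measurable m m" for h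
    by (rule continuous_on_measurable_endo[OF continuous_translation])
  have "distr ?\<nu> ?\<nu> (\<lambda>x. h + x) = ?\<nu>" if h: "h \<in> H" for h
  proof (rule measure_eqI)
    fix A assume "A \<in> sets (distr ?\<nu> ?\<nu> (\<lambda>x. h + x))"
    then have A: "A \<in> sets m" by simp
    have pre: "{x. h + x \<in> A} \<in> sets m" using measurable_sets[OF tm[of h] A] by (simp add: vimage_def)
    have "emeasure (distr ?\<nu> ?\<nu> (\<lambda>x. h + x)) A = emeasure ?\<nu> {x. h + x \<in> A}"
      using A tm[of h] by (subst emeasure_distr) (auto simp: vimage_def)
    also have "\<dots> = emeasure m (B \<inter> {x. h + x \<in> A}) / emeasure m B" using B pre by simp
    also have "B \<inter> {x. h + x \<in> A} = {x. h + x \<in> B \<inter> A}" using inv[OF h] by auto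
    also have "emeasure m {x. h + x \<in> B \<inter> A} = emeasure m (B \<inter> A)"
      by (rule emeasure_translation) (use A B in auto)
    also have "emeasure m (B \<inter> A) / emeasure m B = emeasure ?\<nu> A" using A B by simp
    finally show "emeasure (distr ?\<nu> ?\<nu> (\<lambda>x. h + x)) A = emeasure ?\<nu> A" .
  qed simp
  then have "?\<nu> = m"
    by (intro invariant_measure_unique[OF prob _ compact_regular_uniform_measure[OF B False] _ sep]) simp_all
  then have "emeasure m B = emeasure ?\<nu> B" by simp
  also have "\<dots> = 1" using False by (intro emeasure_uniform_measure_1) simp_all
  finally show ?thesis ..
qed simp

text \<open>The zero-one law is used once per coordinate: for each \<open>y\<close> the slice of
  \<open>Q\<close> is \<open>H\<close>-invariant, and the set \<open>C\<close> of those
  \<open>y\<close> with full slice is \<open>H'\<close>-invariant. Characters of the product group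
  are not involved.\<close>

lemma invariant_pair_set_trivial:
  assumes Q: "Q \<in> sets (m \<Otimes>\<^sub>M m)" and sep: "separating_subset H" "separating_subset H'"
    and inv: "\<And>h x y. h \<in> H \<Longrightarrow> (h + x, y) \<in> Q \<longleftrightarrow> (x, y) \<in> Q"
      "\<And>h x y. h \<in> H' \<Longrightarrow> (x, h + y) \<in> Q \<longleftrightarrow> (x, y) \<in> Q"
  shows "emeasure (m \<Otimes>\<^sub>M m) Q = 0 \<or> emeasure (m \<Otimes>\<^sub>M m) Q = 1"
proof -
  interpret P: pair_sigma_finite m m ..
  define s where "s y = emeasure m ((\<lambda>x. (x, y)) -` Q)" for y
  have s01: "s y = 0 \<or> s y = 1" for y
    unfolding s_def
  proof (rule invariant_set_trivial[OF _ sep(1)])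
    show "(\<lambda>x. (x, y)) -` Q \<in> sets borel" using sets_Pair2[OF Q] by simp
  qed (use inv(1) in auto)
  define C where "C = {y. s y = 1}"
  have [measurable]: "s \<in> borel_measurable m"
    using P.measurable_emeasure_Pair2[OF Q] by (simp add: s_def[abs_def])
  have "{y \<in> space m. s y = 1} \<in> sets m" by measurable
  then have C: "C \<in> sets borel" by (simp add: C_def)
  have "emeasure (m \<Otimes>\<^sub>M m) Q = (\<integral>\<^sup>+y. s y \<partial>m)"
    unfolding s_def by (rule P.emeasure_pair_measure_alt2[OF Q])
  also have "\<dots> = (\<integral>\<^sup>+y. indicator C y \<partial>m)"
    using s01 by (intro nn_integral_cong) (auto simp: C_def indicator_def)
  also have "\<dots> = emeasure m C" using C by simp
  finally have "emeasure (m \<Otimes>\<^sub>M m) Q = emeasure m C" .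
  moreover have "emeasure m C = 0 \<or> emeasure m C = 1"
  proof (rule invariant_set_trivial[OF C sep(2)])
    fix h x assume h: "h \<in> H'"
    have "s (h + x) = s x" unfolding s_def by (rule arg_cong[of _ _ "emeasure m"]) (use inv(2)[OF h] in auto)
    then show "h + x \<in> C \<longleftrightarrow> x \<in> C" by (simp add: C_def)
  qed
  ultimately show ?thesis by simp
qed

end

section \<open>Fourier tightness and kernels of the cocycle\<close>

text \<open>Triviality on the kernel makes \<open>\<eta>\<close> independent of the chosen preimage.
  It is continuous because \<open>\<tau>\<close>, mapping a compact space to a Hausdorff one, is
  closed, and the \<open>\<eta>\<close>-preimage of a set is the \<open>\<tau>\<close>-image of its
  \<open>\<gamma>\<close>-preimage.\<close>

lemma dual_group_factor:
  fixes \<tau> :: "'g::{topological_ab_group_add, t2_space} \<Rightarrow> 'g"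
  assumes comp: "compact (UNIV :: 'g set)" and \<tau>: "\<tau> \<in> Epi" and \<gamma>: "\<gamma> \<in> dual_group"
    and ker: "\<And>k. \<tau> k = 0 \<Longrightarrow> \<gamma> k = 1"
  obtains \<eta> where "\<eta> \<in> dual_group" "\<gamma> = adjoint_endo \<tau> \<eta>"
proof -
  have c\<tau>: "continuous_on UNIV \<tau>" and add\<tau>: "\<tau> (x + y) = \<tau> x + \<tau> y" and surj\<tau>: "surj \<tau>" for x y
    using \<tau> by (auto simp: Epi_def Modules.additive_def)
  have c\<gamma>: "continuous_on UNIV \<gamma>" and n\<gamma>: "cmod (\<gamma> x) = 1" and add\<gamma>: "\<gamma> (x + y) = \<gamma> x * \<gamma> y" for x y
    using \<gamma> unfolding dual_group_def by blast+
  define \<eta> where "\<eta> y = \<gamma> (inv \<tau> y)" for y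
  have factor: "\<eta> (\<tau> x) = \<gamma> x" for x
  proof -
    define k where "k = inv \<tau> (\<tau> x) - x"
    have "\<tau> (x + k) = \<tau> x" unfolding k_def using surj_f_inv_f[OF surj\<tau>] by simp
    then have "\<tau> k = 0" by (simp add: add\<tau>)
    then have "\<gamma> (x + k) = \<gamma> x" using ker[of k] by (simp add: add\<gamma>)
    then show ?thesis by (simp add: \<eta>_def k_def)
  qed
  have "\<eta> (x + y) = \<eta> x * \<eta> y" for x y
  proof -
    obtain a b where "x = \<tau> a" "y = \<tau> b" using surj\<tau> by (metis surjD)
    then show ?thesis using factor[of "a + b"] by (simp add: add\<tau> factor add\<gamma>)
  qed
  moreover have "cmod (\<eta> x) = 1" for x by (simp add: \<eta>_def n\<gamma>)
  moreover have "continuous_on UNIV \<eta>"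
  proof -
    have "closed (\<eta> -` C)" if C: "closed C" for C
    proof -
      have "\<eta> -` C = \<tau> ` (\<gamma> -` C)"
      proof (intro equalityI subsetI)
        fix y assume "y \<in> \<eta> -` C"
        then show "y \<in> \<tau> ` (\<gamma> -` C)"
          using surj_f_inv_f[OF surj\<tau>, of y] by (intro image_eqI[of _ _ "inv \<tau> y"]) (auto simp: \<eta>_def)
      qed (auto simp: factor)
      moreover have "closed (\<gamma> -` C)" by (rule closed_vimage[OF C c\<gamma>])
      then have "compact (\<gamma> -` C)" using closed_Int_compact[OF _ comp] by force
      then have "compact (\<tau> ` (\<gamma> -` C))"
        by (intro compact_continuous_image continuous_on_subset[OF c\<tau>]) simp_all
      ultimately show ?thesis by (simp add: compact_imp_closed)
    qed
    then show ?thesis by (simp add: continuous_on_closed_vimage)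
  qed
  ultimately have "\<eta> \<in> dual_group" by (simp add: dual_group_def)
  moreover have "\<gamma> = adjoint_endo \<tau> \<eta>" by (auto simp: adjoint_endo_def factor)
  ultimately show ?thesis by (rule that)
qed

lemma cocycle_Epi:
  assumes "\<omega> \<in> Omega"
  shows "cocycle \<omega> n \<in> Epi"
proof (induction n)
  case 0
  show ?case by (auto simp: Epi_def Modules.additive_def intro: continuous_on_id)
next
  case (Suc n)
  have "\<omega> n \<in> Epi" using assms by (auto simp: Omega_def)
  with Suc have "continuous_on UNIV (\<omega> n \<circ> cocycle \<omega> n)" "surj (\<omega> n \<circ> cocycle \<omega> n)"
    by (auto simp: Epi_def simp del: o_apply intro!: comp_surj continuous_on_compose
        intro: continuous_on_subset)
  moreover have "Modules.additive (\<omega> n \<circ> cocycle \<omega> n)"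
    using \<open>\<omega> n \<in> Epi\<close> Suc by (simp add: Epi_def Modules.additive_def)
  ultimately show ?case unfolding Epi_def cocycle.simps by blast
qed

lemma (in compact_haar_group) tight_kernels_separating:
  assumes \<omega>: "\<omega> \<in> Omega"
    and tight: "\<forall>\<Gamma>. finite \<Gamma> \<and> \<Gamma> \<subseteq> dual_group \<longrightarrow>
     (\<exists>m0. \<forall>m\<ge>m0. adjoint_endo (cocycle \<omega> m) ` (dual_group - {trivial_character})
        \<subseteq> dual_group - \<Gamma>)"
  shows "separating_subset (\<Union>n. {k. cocycle \<omega> n k = (0::'g)})"
  unfolding separating_subset_def
proof (intro ballI impI)
  fix \<gamma> :: "'g \<Rightarrow> complex" assume \<gamma>: "\<gamma> \<in> dual_group"
  assume ker: "\<forall>h\<in>\<Union>n. {k. cocycle \<omega> n k = 0}. \<gamma> h = 1"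
  show "\<gamma> = trivial_character"
  proof (rule ccontr)
    assume nontrivial: "\<gamma> \<noteq> trivial_character"
    \<comment> \<open>Tightness is applied to the singleton of the character in question, at the
      single time \<open>n\<close> given by the threshold.\<close>
    have "finite {\<gamma>} \<and> {\<gamma>} \<subseteq> dual_group" using \<gamma> by simp
    from tight[rule_format, OF this] obtain n where
      n: "adjoint_endo (cocycle \<omega> n) ` (dual_group - {trivial_character}) \<subseteq> dual_group - {\<gamma>}"
      by auto
    obtain \<eta> where \<eta>: "\<eta> \<in> dual_group" "\<gamma> = adjoint_endo (cocycle \<omega> n) \<eta>"
    proof (rule dual_group_factor[OF compact_UNIV cocycle_Epi[OF \<omega>, of n] \<gamma>])
      show "\<gamma> k = 1" if "cocycle \<omega> n k = 0" for k using ker that by auto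
    qed
    have "\<eta> \<noteq> trivial_character"
      using \<eta>(2) nontrivial by (auto simp: adjoint_endo_def trivial_character_def)
    then have "\<gamma> \<in> adjoint_endo (cocycle \<omega> n) ` (dual_group - {trivial_character})"
      unfolding \<eta>(2) using \<eta>(1) by (intro imageI) simp
    then show False using n by auto
  qed
qed

section \<open>Products of measure preserving maps\<close>

lemma measure_preserving_map_pair:
  assumes "prob_space M" "measure_preserving_map M T"
  shows "measure_preserving_map (M \<Otimes>\<^sub>M M) (\<lambda>(x, y). (T x, T y))"
proof -
  interpret prob_space M by fact
  have T [measurable]: "T \<in> measurable M M" and distr: "distr M M T = M"
    using assms(2) by (auto simp: measure_preserving_map_def)
  have "sigma_finite_measure (distr M M T)" unfolding distr ..
  from pair_measure_distr[OF T T this] show ?thesis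
    by (simp add: measure_preserving_map_def distr)
qed

text \<open>Regroups the integrals so that both base variables are outside and both fibre variables
  inside, as the fibrewise argument requires.\<close>

lemma emeasure_pair_pair:
  assumes "prob_space M" "prob_space N" and A: "A \<in> sets ((M \<Otimes>\<^sub>M N) \<Otimes>\<^sub>M (M \<Otimes>\<^sub>M N))"
  shows "emeasure ((M \<Otimes>\<^sub>M N) \<Otimes>\<^sub>M (M \<Otimes>\<^sub>M N)) A =
    (\<integral>\<^sup>+v. \<integral>\<^sup>+w. \<integral>\<^sup>+x. \<integral>\<^sup>+y. indicator A ((v, x), (w, y)) \<partial>N \<partial>N \<partial>M \<partial>M)"
proof -
  interpret M: prob_space M by fact
  interpret N: prob_space N by fact
  interpret MN: pair_prob_space M N ..
  interpret NM: pair_prob_space N M ..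
  have sf: "sigma_finite_measure (M \<Otimes>\<^sub>M N)" ..
  note [measurable] = A
  have "emeasure ((M \<Otimes>\<^sub>M N) \<Otimes>\<^sub>M (M \<Otimes>\<^sub>M N)) A = (\<integral>\<^sup>+z. indicator A z \<partial>((M \<Otimes>\<^sub>M N) \<Otimes>\<^sub>M (M \<Otimes>\<^sub>M N)))"
    using A by simp
  also have "\<dots> = (\<integral>\<^sup>+p. \<integral>\<^sup>+q. indicator A (p, q) \<partial>(M \<Otimes>\<^sub>M N) \<partial>(M \<Otimes>\<^sub>M N))"
    by (rule sigma_finite_measure.nn_integral_fst[OF sf, symmetric]) measurable
  also have "\<dots> = (\<integral>\<^sup>+p. \<integral>\<^sup>+w. \<integral>\<^sup>+y. indicator A (p, (w, y)) \<partial>N \<partial>M \<partial>(M \<Otimes>\<^sub>M N))"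
    by (intro nn_integral_cong N.nn_integral_fst[symmetric]) measurable
  also have "\<dots> = (\<integral>\<^sup>+v. \<integral>\<^sup>+x. \<integral>\<^sup>+w. \<integral>\<^sup>+y. indicator A ((v, x), (w, y)) \<partial>N \<partial>M \<partial>N \<partial>M)"
    by (rule N.nn_integral_fst[symmetric]) measurable
  also have "\<dots> = (\<integral>\<^sup>+v. \<integral>\<^sup>+w. \<integral>\<^sup>+x. \<integral>\<^sup>+y. indicator A ((v, x), (w, y)) \<partial>N \<partial>N \<partial>M \<partial>M)"
    by (intro nn_integral_cong NM.Fubini'[symmetric]) measurable
  finally show ?thesis .
qed

section \<open>Skew products of epimorphisms\<close>

locale skew_product_base = compact_haar_group m
  for m :: "'g::{topological_ab_group_add, t2_space} measure" +
  fixes \<mu> :: "(nat \<Rightarrow> 'g \<Rightarrow> 'g) measure"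
  assumes base: "epi_base \<mu>"
    and invariant: "measure_preserving_map \<mu> shift_map"
begin

sublocale mu: prob_space \<mu>
  using base by (simp add: epi_base_def)

lemma space_\<mu>: "space \<mu> = Omega"
  using base by (simp add: epi_base_def)

lemma shift_measurable [measurable]: "shift_map \<in> measurable \<mu> \<mu>"
  using base by (simp add: epi_base_def)

lemma evaluation_measurable [measurable]: "(\<lambda>p. fst p 0 (snd p)) \<in> measurable (\<mu> \<Otimes>\<^sub>M m) m"
proof -
  have sets: "sets (\<mu> \<Otimes>\<^sub>M m) = sets (\<mu> \<Otimes>\<^sub>M borel)" by (rule sets_pair_measure_cong) simp_all
  have "(\<lambda>(\<omega>, x). \<omega> 0 x) \<in> measurable (\<mu> \<Otimes>\<^sub>M borel) borel" using base by (simp add: epi_base_def)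
  then show ?thesis using measurable_cong_sets[OF sets sets_m] by (simp add: split_beta')
qed

lemma skew_product_measurable [measurable]: "skew_product \<in> measurable (\<mu> \<Otimes>\<^sub>M m) (\<mu> \<Otimes>\<^sub>M m)"
  unfolding skew_product_def split_beta' by measurable

lemma shift_Omega: "\<omega> \<in> Omega \<Longrightarrow> shift_map \<omega> \<in> Omega"
  by (auto simp: Omega_def shift_map_def)

text \<open>The fibre of the preimage over \<open>\<omega>\<close> is the preimage under
  \<open>\<omega> 0\<close> of the fibre over the shifted sequence. Epimorphisms preserve
  \<open>m\<close>, so only the fibre measure along the shift remains, and \<open>\<mu>\<close> is
  shift invariant.\<close>

lemma skew_product_preserves: "measure_preserving_map (\<mu> \<Otimes>\<^sub>M m) skew_product"
  unfolding measure_preserving_map_def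
proof
  show "distr (\<mu> \<Otimes>\<^sub>M m) (\<mu> \<Otimes>\<^sub>M m) skew_product = \<mu> \<Otimes>\<^sub>M m"
  proof (rule measure_eqI)
    fix A assume "A \<in> sets (distr (\<mu> \<Otimes>\<^sub>M m) (\<mu> \<Otimes>\<^sub>M m) skew_product)"
    then have A [measurable]: "A \<in> sets (\<mu> \<Otimes>\<^sub>M m)" by simp
    define e where "e \<omega> = emeasure m (Pair \<omega> -` A)" for \<omega>
    have e [measurable]: "e \<in> borel_measurable \<mu>"
      using measurable_emeasure_Pair[OF A] by (simp add: e_def[abs_def])
    have pre: "skew_product -` A \<inter> space (\<mu> \<Otimes>\<^sub>M m) \<in> sets (\<mu> \<Otimes>\<^sub>M m)"
      by (rule measurable_sets[OF skew_product_measurable A])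
    have fibre: "emeasure m (Pair \<omega> -` (skew_product -` A \<inter> space (\<mu> \<Otimes>\<^sub>M m))) = e (shift_map \<omega>)"
      if \<omega>: "\<omega> \<in> space \<mu>" for \<omega>
    proof -
      have "\<omega> 0 \<in> Epi" using \<omega> by (auto simp: space_\<mu> Omega_def)
      moreover have "Pair (shift_map \<omega>) -` A \<in> sets borel" using sets_Pair1[OF A] by simp
      ultimately have "emeasure m {x. \<omega> 0 x \<in> Pair (shift_map \<omega>) -` A} = e (shift_map \<omega>)"
        unfolding e_def by (rule emeasure_Epi)
      moreover have "{x. \<omega> 0 x \<in> Pair (shift_map \<omega>) -` A}
          = Pair \<omega> -` (skew_product -` A \<inter> space (\<mu> \<Otimes>\<^sub>M m))"
        using \<omega> by (auto simp: skew_product_def space_pair_measure)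
      ultimately show ?thesis by simp
    qed
    have "emeasure (distr (\<mu> \<Otimes>\<^sub>M m) (\<mu> \<Otimes>\<^sub>M m) skew_product) A
        = emeasure (\<mu> \<Otimes>\<^sub>M m) (skew_product -` A \<inter> space (\<mu> \<Otimes>\<^sub>M m))"
      by (rule emeasure_distr[OF skew_product_measurable A])
    also have "\<dots> = (\<integral>\<^sup>+\<omega>. e (shift_map \<omega>) \<partial>\<mu>)"
      unfolding emeasure_pair_measure_alt[OF pre] by (rule nn_integral_cong) (rule fibre)
    also have "(\<integral>\<^sup>+\<omega>. e (shift_map \<omega>) \<partial>\<mu>) = (\<integral>\<^sup>+\<omega>. e \<omega> \<partial>distr \<mu> \<mu> shift_map)" by (rule nn_integral_distr[symmetric]) measurable
    also have "\<dots> = emeasure (\<mu> \<Otimes>\<^sub>M m) A"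
      using invariant by (simp add: measure_preserving_map_def e_def emeasure_pair_measure_alt[OF A])
    finally show "emeasure (distr (\<mu> \<Otimes>\<^sub>M m) (\<mu> \<Otimes>\<^sub>M m) skew_product) A = emeasure (\<mu> \<Otimes>\<^sub>M m) A" .
  qed simp
qed measurable

lemma skew_product_pair_ergodic:
  assumes tight: "Fourier_tight \<mu>" and mixing: "weakly_mixing_map \<mu> shift_map"
    and A: "A \<in> sets ((\<mu> \<Otimes>\<^sub>M m) \<Otimes>\<^sub>M (\<mu> \<Otimes>\<^sub>M m))"
    and inv: "(\<lambda>(p, q). (skew_product p, skew_product q)) -` A
      \<inter> space ((\<mu> \<Otimes>\<^sub>M m) \<Otimes>\<^sub>M (\<mu> \<Otimes>\<^sub>M m)) = A"
  shows "emeasure ((\<mu> \<Otimes>\<^sub>M m) \<Otimes>\<^sub>M (\<mu> \<Otimes>\<^sub>M m)) A = 0 \<or> emeasure ((\<mu> \<Otimes>\<^sub>M m) \<Otimes>\<^sub>M (\<mu> \<Otimes>\<^sub>M m)) A = 1"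
proof -
  interpret mm: pair_prob_space m m ..
  interpret mumu: pair_prob_space \<mu> \<mu> ..
  note [measurable] = A
  define F where "F v w = {(x, y). ((v, x), (w, y)) \<in> A}" for v w
  have step: "((v, x), (w, y)) \<in> A \<longleftrightarrow> ((shift_map v, v 0 x), (shift_map w, w 0 y)) \<in> A"
    if "v \<in> Omega" "w \<in> Omega" for v w x y
  proof -
    have "((v, x), (w, y)) \<in> space ((\<mu> \<Otimes>\<^sub>M m) \<Otimes>\<^sub>M (\<mu> \<Otimes>\<^sub>M m))"
      using that by (simp add: space_pair_measure space_\<mu>)
    then have "((v, x), (w, y)) \<in> A
        \<longleftrightarrow> (case ((v, x), (w, y)) of (p, q) \<Rightarrow> (skew_product p, skew_product q)) \<in> A"
      using inv by blast
    then show ?thesis by (simp add: skew_product_def)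
  qed
  \<comment> \<open>This holds at every point, for the same \<open>n\<close> in both coordinates; a
    kernel element of either cocycle can then be added in its own coordinate without affecting the
    right-hand side.\<close>
  have iterate: "((v, x), (w, y)) \<in> A \<longleftrightarrow>
      (((shift_map ^^ n) v, cocycle v n x), ((shift_map ^^ n) w, cocycle w n y)) \<in> A"
    if vw: "v \<in> Omega" "w \<in> Omega" for v w x y n
  proof (induction n)
    case (Suc n)
    have "(shift_map ^^ n) u 0 = u n" for u :: "nat \<Rightarrow> 'g \<Rightarrow> 'g"
    proof -
      have "(shift_map ^^ n) u k = u (k + n)" for k
        by (induction n arbitrary: k) (simp_all add: shift_map_def)
      then show ?thesis by simp
    qed
    moreover have "(shift_map ^^ n) u \<in> Omega" if "u \<in> Omega" for u :: "nat \<Rightarrow> 'g \<Rightarrow> 'g"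
      using that by (induction n) (simp_all add: shift_Omega)
    ultimately show ?case using Suc step vw by simp
  qed simp
  have F_sets: "F v w \<in> sets (m \<Otimes>\<^sub>M m)" if vw: "v \<in> Omega" "w \<in> Omega" for v w
  proof -
    have [measurable]: "v \<in> space \<mu>" "w \<in> space \<mu>" using vw by (simp_all add: space_\<mu>)
    have "(\<lambda>(x, y). ((v, x), (w, y))) \<in> measurable (m \<Otimes>\<^sub>M m) ((\<mu> \<Otimes>\<^sub>M m) \<Otimes>\<^sub>M (\<mu> \<Otimes>\<^sub>M m))"
      by measurable
    from measurable_sets[OF this A] show ?thesis
      by (simp add: F_def vimage_def split_beta' space_pair_measure)
  qed
  define e where "e = (\<lambda>(v, w). \<integral>\<^sup>+x. \<integral>\<^sup>+y. indicator A ((v, x), (w, y)) \<partial>m \<partial>m)"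
  have e_meas [measurable]: "e \<in> borel_measurable (\<mu> \<Otimes>\<^sub>M \<mu>)"
    unfolding e_def by measurable
  have e_F: "e (v, w) = emeasure (m \<Otimes>\<^sub>M m) (F v w)" if vw: "v \<in> Omega" "w \<in> Omega" for v w
  proof -
    have "emeasure (m \<Otimes>\<^sub>M m) (F v w) = (\<integral>\<^sup>+x. \<integral>\<^sup>+y. indicator (F v w) (x, y) \<partial>m \<partial>m)"
      by (rule emeasure_pair_measure[OF F_sets[OF vw]])
    then show ?thesis by (simp add: e_def F_def indicator_def)
  qed
  have total: "emeasure ((\<mu> \<Otimes>\<^sub>M m) \<Otimes>\<^sub>M (\<mu> \<Otimes>\<^sub>M m)) A = (\<integral>\<^sup>+v. \<integral>\<^sup>+w. e (v, w) \<partial>\<mu> \<partial>\<mu>)"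
    using emeasure_pair_pair[OF mu.prob_space_axioms prob_space_axioms A] by (simp add: e_def)
  \<comment> \<open>Base pairs whose fibre is full. On pairs obeying the zero-one law
    \<open>e\<close> is the indicator of \<open>E\<close>.\<close>
  define E where "E = {p \<in> space (\<mu> \<Otimes>\<^sub>M \<mu>). e p = 1}"
  have E [measurable]: "E \<in> sets (\<mu> \<Otimes>\<^sub>M \<mu>)" unfolding E_def by measurable
  \<comment> \<open>Proved for all pairs in \<open>Omega\<close>, so that \<open>E\<close> is
    strictly invariant, as \<open>ergodic_map\<close> demands of its sets.\<close>
  have e_shift: "e (shift_map v, shift_map w) = e (v, w)" if vw: "v \<in> Omega" "w \<in> Omega" for v w
  proof -
    have Epi: "v 0 \<in> Epi" "w 0 \<in> Epi" using vw by (auto simp: Omega_def)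
    have meas [measurable]: "v 0 \<in> measurable m m" "w 0 \<in> measurable m m"
      using Epi by (auto simp: Epi_def intro: continuous_on_measurable_endo)
    have "sigma_finite_measure (distr m m (w 0))" unfolding distr_Epi[OF Epi(2)] ..
    from pair_measure_distr[OF meas this]
    have "m \<Otimes>\<^sub>M m = distr (m \<Otimes>\<^sub>M m) (m \<Otimes>\<^sub>M m) (\<lambda>(x, y). (v 0 x, w 0 y))"
      by (simp add: distr_Epi Epi)
    then have "emeasure (m \<Otimes>\<^sub>M m) (F (shift_map v) (shift_map w))
        = emeasure (distr (m \<Otimes>\<^sub>M m) (m \<Otimes>\<^sub>M m) (\<lambda>(x, y). (v 0 x, w 0 y))) (F (shift_map v) (shift_map w))"
      by simp
    also have "\<dots> = emeasure (m \<Otimes>\<^sub>M m) ((\<lambda>(x, y). (v 0 x, w 0 y)) -` F (shift_map v) (shift_map w) \<inter> space (m \<Otimes>\<^sub>M m))"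
      by (rule emeasure_distr) (use F_sets shift_Omega vw in \<open>measurable\<close>)
    also have "(\<lambda>(x, y). (v 0 x, w 0 y)) -` F (shift_map v) (shift_map w) \<inter> space (m \<Otimes>\<^sub>M m) = F v w"
      using step[OF vw] by (auto simp: F_def space_pair_measure)
    finally show ?thesis by (simp add: e_F shift_Omega vw)
  qed
  have "(\<lambda>(v, w). (shift_map v, shift_map w)) -` E \<inter> space (\<mu> \<Otimes>\<^sub>M \<mu>) = E"
    using e_shift shift_Omega by (auto simp: E_def space_pair_measure space_\<mu>)
  then have "measure (\<mu> \<Otimes>\<^sub>M \<mu>) E = 0 \<or> measure (\<mu> \<Otimes>\<^sub>M \<mu>) E = 1"
    using mixing E by (auto simp: weakly_mixing_map_def ergodic_map_def)
  then have E01: "emeasure (\<mu> \<Otimes>\<^sub>M \<mu>) E = 0 \<or> emeasure (\<mu> \<Otimes>\<^sub>M \<mu>) E = 1"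
    by (auto simp: mumu.emeasure_eq_measure)
  define good where "good \<omega> \<longleftrightarrow> separating_subset (\<Union>n. {k. cocycle \<omega> n k = 0})" for \<omega> :: "nat \<Rightarrow> 'g \<Rightarrow> 'g"
  have AE_good: "AE \<omega> in \<mu>. good \<omega> \<and> \<omega> \<in> Omega"
    using tight[unfolded Fourier_tight_def] AE_space
    by eventually_elim (auto simp: good_def space_\<mu> intro: tight_kernels_separating)
  have e01: "e (v, w) = 0 \<or> e (v, w) = 1"
    if v: "good v \<and> v \<in> Omega" and w: "good w \<and> w \<in> Omega" for v w
  proof -
    have translate: "cocycle u n (k + x) = cocycle u n x" if "u \<in> Omega" "cocycle u n k = 0"
      for u :: "nat \<Rightarrow> 'g \<Rightarrow> 'g" and n k x
      using cocycle_Epi[OF that(1), of n] that(2) by (simp add: Epi_def Modules.additive_def)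
    have "emeasure (m \<Otimes>\<^sub>M m) (F v w) = 0 \<or> emeasure (m \<Otimes>\<^sub>M m) (F v w) = 1"
    proof (rule invariant_pair_set_trivial[OF F_sets])
      show "(h + x, y) \<in> F v w \<longleftrightarrow> (x, y) \<in> F v w" if h: "h \<in> (\<Union>n. {k. cocycle v n k = 0})" for h x y
      proof -
        obtain n where n: "cocycle v n h = 0" using h by auto
        show ?thesis
          using iterate[of v w "h + x" y n] iterate[of v w x y n] translate[OF _ n] v w by (simp add: F_def)
      qed
      show "(x, h + y) \<in> F v w \<longleftrightarrow> (x, y) \<in> F v w" if h: "h \<in> (\<Union>n. {k. cocycle w n k = 0})" for h x y
      proof -
        obtain n where n: "cocycle w n h = 0" using h by auto
        show ?thesis
          using iterate[of v w x "h + y" n] iterate[of v w x y n] translate[OF _ n] v w by (simp add: F_def)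
      qed
    qed (use v w in \<open>simp_all add: good_def\<close>)
    then show ?thesis using e_F v w by simp
  qed
  have "(\<integral>\<^sup>+v. \<integral>\<^sup>+w. e (v, w) \<partial>\<mu> \<partial>\<mu>) = (\<integral>\<^sup>+v. \<integral>\<^sup>+w. indicator E (v, w) \<partial>\<mu> \<partial>\<mu>)"
  proof (rule nn_integral_cong_AE)
    \<comment> \<open>Exceptional sets are removed in one variable at a time, so measurability of
      the set of good pairs does not enter.\<close>
    show "AE v in \<mu>. (\<integral>\<^sup>+w. e (v, w) \<partial>\<mu>) = (\<integral>\<^sup>+w. indicator E (v, w) \<partial>\<mu>)"
      using AE_good
    proof eventually_elim
      fix v assume v: "good v \<and> v \<in> Omega"
      have "AE w in \<mu>. e (v, w) = indicator E (v, w)"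
        using AE_good
      proof eventually_elim
        fix w assume w: "good w \<and> w \<in> Omega"
        show "e (v, w) = indicator E (v, w)"
          using e01[OF v w] v w by (auto simp: E_def space_pair_measure space_\<mu> indicator_def)
      qed
      then show "(\<integral>\<^sup>+w. e (v, w) \<partial>\<mu>) = (\<integral>\<^sup>+w. indicator E (v, w) \<partial>\<mu>)" by (rule nn_integral_cong_AE)
    qed
  qed
  also have "\<dots> = emeasure (\<mu> \<Otimes>\<^sub>M \<mu>) E" by (rule mu.emeasure_pair_measure[OF E, symmetric])
  finally show ?thesis using total E01 by simp
qed

end

theorem theorem4p2:
  fixes m :: "'g::{topological_ab_group_add, t2_space} measure"
    and \<mu> :: "(nat \<Rightarrow> 'g \<Rightarrow> 'g) measure"
  assumes compact_group: "compact (UNIV :: 'g set)"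
    and countable_dual: "countable (dual_group :: ('g \<Rightarrow> complex) set)"
    and haar: "haar_probability m"
    and base: "epi_base \<mu>"
    and invariant: "measure_preserving_map \<mu> shift_map"
    and tight: "Fourier_tight \<mu>"
    and mixing: "weakly_mixing_map \<mu> shift_map"
  shows "weakly_mixing_map (\<mu> \<Otimes>\<^sub>M m) skew_product"
proof -
  interpret m: prob_space m using haar by (simp add: haar_probability_def)
  interpret skew_product_base m \<mu>
    by unfold_locales (use compact_group haar base invariant in auto)
  interpret base_fibre: pair_prob_space \<mu> m ..
  interpret square: pair_prob_space "\<mu> \<Otimes>\<^sub>M m" "\<mu> \<Otimes>\<^sub>M m" ..
  have prob: "prob_space (\<mu> \<Otimes>\<^sub>M m)" by (rule base_fibre.prob_space_axioms)
  have prob2: "prob_space ((\<mu> \<Otimes>\<^sub>M m) \<Otimes>\<^sub>M (\<mu> \<Otimes>\<^sub>M m))"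
    by (rule square.prob_space_axioms)
  show ?thesis
    unfolding weakly_mixing_map_def ergodic_map_def
  proof (intro conjI ballI impI)
    fix A assume "A \<in> sets ((\<mu> \<Otimes>\<^sub>M m) \<Otimes>\<^sub>M (\<mu> \<Otimes>\<^sub>M m))"
      "(\<lambda>(x, y). (skew_product x, skew_product y)) -` A \<inter> space ((\<mu> \<Otimes>\<^sub>M m) \<Otimes>\<^sub>M (\<mu> \<Otimes>\<^sub>M m)) = A"
    from skew_product_pair_ergodic[OF tight mixing this]
    show "measure ((\<mu> \<Otimes>\<^sub>M m) \<Otimes>\<^sub>M (\<mu> \<Otimes>\<^sub>M m)) A = 0 \<or> measure ((\<mu> \<Otimes>\<^sub>M m) \<Otimes>\<^sub>M (\<mu> \<Otimes>\<^sub>M m)) A = 1"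
      by (auto simp: measure_def)
  qed (use prob prob2 skew_product_preserves measure_preserving_map_pair in auto)
qed

end
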